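(* Let $\varepsilon\in\{\mathrm{fwd},\mathrm{bwd}\}$, let $k,N\ge0$ be integers with $k+N$ even, and put $M=N-k$, assumed $\ge0$. Assume $k\ge1$ if $\varepsilon=\mathrm{fwd}$. Let $R\in2\mathbb Z_{\ge0}$. If $M>R$, then $$\mu^{\varepsilon}_{k,N}(j)=\rho^{\mathrm{ev}}(j)\qquad (j\in2\mathbb Z_{\ge0},\ 0\le j\le R).$$ Consequently, if $\Phi:2\mathbb Z_{\ge0}\to\mathbb C$ is supported in $\{0,2,\ldots,R\}$, then $$\int \Phi\,d\mu^{\varepsilon}_{k,N}=\langle\Phi\rangle_{\rho^{\mathrm{ev}}}.$$
   Context: Let $q$ be a prime power, $F=\mathbb F_q((t^{-1}))$, $\mathcal O=\mathbb F_q[[t^{-1}]]$, $\pi=t^{-1}$. $\mathcal T$ is the Bruhat--Tits tree of $\mathrm{PGL}_2(F)$: vertices are homothety classes $[L]$ of $\mathcal O$-lattices in $F^2$, adjacent if representatives can be chosen with $\pi L\subsetneq L'\subsetneq L$, $L/L'\simeq\mathbb F_q$; it is $(q+1)$-regular. Put $v_n=[\mathrm{diag}(t^n,1)]\cdot[\mathcal O^2]$. The quotient of $\mathcal T$ by $\mathrm{PGL}_2(\mathbb F_q[t])$ is a ray represented by $v_0-v_1-\cdots$, and the height $h(v)$ of a vertex is the $n\ge0$ for which $v$ lies in the orbit of $v_n$. All neighbors of a height-$0$ vertex have height $1$; a vertex of height $k\ge1$ has exactly one neighbor of height $k+1$ and exactly $q$ of height $k-1$. An oriented edge $e=(z_{-1},z_0)$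 with $h(z_0)=k$ is forward (state $(\mathrm{fwd},k)$, $k\ge1$) if $h(z_{-1})=k-1$, backward (state $(\mathrm{bwd},k)$, $k\ge0$) if $h(z_{-1})=k+1$. $\mathrm{Desc}_N(e)$ is the set of terminal vertices $z_N$ of non-backtracking paths $z_{-1}\to z_0\to\cdots\to z_N$ ($q^N$ elements). $\mu^{\varepsilon}_{k,N}(j)$ is $q^{-N}$ times the number of vertices of height $j$ in $\mathrm{Desc}_N(e)$ for $e$ in state $(\varepsilon,k)$; this depends only on the state. $\rho^{\mathrm{ev}}$ on $2\mathbb Z_{\ge0}$: $\rho^{\mathrm{ev}}(0)=\frac{q-1}{q}$, $\rho^{\mathrm{ev}}(2m)=(q^2-1)q^{-2m-1}$ for $m\ge1$; $\langle\Phi\rangle_{\rho^{\mathrm{ev}}}=\sum_{m\ge0}\rho^{\mathrm{ev}}(2m)\Phi(2m)$. *)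

theory Defs
  imports
    "HOL-Analysis.Analysis"
    "HOL-Computational_Algebra.Computational_Algebra"
begin

(* The finite field F_q is a type 'a :: {field, finite}, with q = CARD('a), and F = F_q((1/t)) is
   'a fls: the library's Laurent variable fls_X is the uniformizer pi = 1/t, and
   fls_X_inv is t.  The ring of integers O = F_q[[1/t]] is the type 'a fps, embedded by fps_to_fls. *)

section \<open>The Bruhat--Tits tree\<close>

definition O_scale :: "'a::field fps \<Rightarrow> 'a fls ^ 2 \<Rightarrow> 'a fls ^ 2" where
  "O_scale a x = fps_to_fls a *s x"

interpretation O_mod: module "O_scale :: 'a::field fps \<Rightarrow> 'a fls ^ 2 \<Rightarrow> 'a fls ^ 2"
  by unfold_locales
    (simp_all add: O_scale_def vec_eq_iff fls_times_fps_to_fls algebra_simps)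

definition is_lattice :: "('a::field fls ^ 2) set \<Rightarrow> bool" where
  "is_lattice L \<longleftrightarrow> (\<exists>S. finite S \<and> L = O_mod.span S) \<and> vec.span L = UNIV"

definition standard_lattice :: "('a::field fls ^ 2) set" where
  "standard_lattice = {x. \<forall>i. x $ i \<in> range fps_to_fls}"

definition homothety_class :: "('a::field fls ^ 2) set \<Rightarrow> ('a fls ^ 2) set set" where
  "homothety_class L = {(\<lambda>x. c *s x) ` L | c. c \<noteq> 0}"

type_synonym 'a vertex = "('a fls ^ 2) set set"

(* For O-lattices L' \<subseteq> L: an O-module isomorphism from L/L' to F_q, given as an O-linear
   surjection from L onto F_q with kernel L'.  The module F_q is the residue field of O, on which
   a power series acts through its constant coefficient. *)
definition quotient_iso_residue :: "('a::field fls ^ 2) set \<Rightarrow> ('a fls ^ 2) set \<Rightarrow> bool" where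
  "quotient_iso_residue L L' \<longleftrightarrow> (\<exists>\<phi> :: 'a fls ^ 2 \<Rightarrow> 'a.
     (\<forall>x\<in>L. \<forall>y\<in>L. \<phi> (x + y) = \<phi> x + \<phi> y) \<and>
     (\<forall>a. \<forall>x\<in>L. \<phi> (O_scale a x) = fps_nth a 0 * \<phi> x) \<and>
     \<phi> ` L = UNIV \<and> {x \<in> L. \<phi> x = 0} = L')"

definition tree_adj :: "'a::field vertex \<Rightarrow> 'a vertex \<Rightarrow> bool" where
  "tree_adj v w \<longleftrightarrow> (\<exists>L L'. is_lattice L \<and> is_lattice L' \<and>
     v = homothety_class L \<and> w = homothety_class L' \<and>
     (\<lambda>x. fls_X *s x) ` L \<subset> L' \<and> L' \<subset> L \<and> quotient_iso_residue L L')"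


section \<open>Heights\<close>

definition polynomials_in_t :: "'a::field fls set" where
  "polynomials_in_t = range (\<lambda>p. poly (map_poly fls_const p) fls_X_inv)"

definition GL2_poly :: "('a::field fls ^ 2 ^ 2) set" where
  "GL2_poly = {A. (\<forall>i j. A $ i $ j \<in> polynomials_in_t) \<and>
     (\<exists>B. (\<forall>i j. B $ i $ j \<in> polynomials_in_t) \<and> A ** B = mat 1 \<and> B ** A = mat 1)}"

(* The action of PGL_2(F) on homothety classes, through representatives in GL_2(F). *)
definition act :: "'a::field fls ^ 2 ^ 2 \<Rightarrow> 'a vertex \<Rightarrow> 'a vertex" where
  "act A v = (\<lambda>L. (\<lambda>x. A *v x) ` L) ` v"

definition ray_vertex :: "nat \<Rightarrow> 'a::field vertex" where
  "ray_vertex n =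
     act (vector [vector [fls_X_inv ^ n, 0], vector [0, 1]]) (homothety_class standard_lattice)"

definition height :: "'a::field vertex \<Rightarrow> nat" where
  "height v = (THE n. \<exists>A\<in>GL2_poly. v = act A (ray_vertex n))"


section \<open>Descendants of an oriented edge\<close>

datatype orientation = Fwd | Bwd

fun state_edges :: "orientation \<Rightarrow> nat \<Rightarrow> ('a::field vertex \<times> 'a vertex) set" where
  "state_edges Fwd k = {(y, z). tree_adj y z \<and> height z = k \<and> k = height y + 1}"
| "state_edges Bwd k = {(y, z). tree_adj y z \<and> height z = k \<and> height y = k + 1}"

(* The path z_{-1}, z_0, ..., z_N is indexed with a shift: p i stands for z_{i-1}. *)
definition Desc :: "nat \<Rightarrow> 'a::field vertex \<times> 'a vertex \<Rightarrow> 'a vertex set" where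
  "Desc N e = {w. \<exists>p :: nat \<Rightarrow> 'a vertex.
     p 0 = fst e \<and> p 1 = snd e \<and> p (N + 1) = w \<and>
     (\<forall>i\<le>N. tree_adj (p i) (p (i + 1))) \<and>
     (\<forall>i<N. p (i + 2) \<noteq> p i)}"

definition desc_freq :: "nat \<Rightarrow> 'a::{field,finite} vertex \<times> 'a vertex \<Rightarrow> nat \<Rightarrow> real" where
  "desc_freq N e j = real (card {w \<in> Desc N e. height w = j}) / real CARD('a) ^ N"

(* The common value of desc_freq on all edges in the given state.  By the_elem, it is determined
   only if that set of values is a singleton, so any equation for mu includes the fact that the
   state is inhabited and that the frequency depends only on the state. *)
definition mu :: "'a::{field,finite} itself \<Rightarrow> orientation \<Rightarrow> nat \<Rightarrow> nat \<Rightarrow> nat \<Rightarrow> real" where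
  "mu (_ :: 'a itself) \<epsilon> k N j =
     the_elem ((\<lambda>e. desc_freq N e j) ` (state_edges \<epsilon> k :: ('a vertex \<times> 'a vertex) set))"

(* The measure on the even heights with point masses mu; used for k + N even, when all vertices
   of Desc N e have even height. *)
definition mu_measure :: "'a::{field,finite} itself \<Rightarrow> orientation \<Rightarrow> nat \<Rightarrow> nat \<Rightarrow> nat measure" where
  "mu_measure T \<epsilon> k N = point_measure {j. even j} (\<lambda>j. ennreal (mu T \<epsilon> k N j))"


section \<open>The limiting distribution on even heights\<close>

(* Extended by 0 to odd arguments. *)
definition rho_ev :: "nat \<Rightarrow> nat \<Rightarrow> real" where
  "rho_ev q j =
     (if j = 0 then (real q - 1) / real q
      else if even j then ((real q)\<^sup>2 - 1) * real q powi (- int j - 1)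
      else 0)"

definition rho_ev_pairing :: "nat \<Rightarrow> (nat \<Rightarrow> complex) \<Rightarrow> complex" where
  "rho_ev_pairing q \<Phi> = (\<Sum>m. complex_of_real (rho_ev q (2 * m)) * \<Phi> (2 * m))"

end

theory Submission
  imports Defs "HOL-Library.Set_Algebras"
begin

text \<open>
  The height of the endpoint of a random non-backtracking path is a two-state walk. From
  \<open>(Bwd, k)\<close> with \<open>k > 0\<close> the path must descend, from \<open>(Bwd, 0)\<close> it must turn to \<open>(Fwd, 1)\<close>,
  and from \<open>(Fwd, k)\<close> it continues upwards with probability \<open>1 / q\<close> and otherwise turns
  downwards. Reaching height 0 from \<open>(Bwd, k)\<close> takes exactly \<open>k\<close> steps, and an excursion that
  makes \<open>i\<close> further upward steps from \<open>(Fwd, k)\<close> takes \<open>k + 2 * i\<close> steps to come back to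
  \<open>(Bwd, 0)\<close>. The returns to 0 therefore form a renewal process with geometric waiting times,
  for which the return probability is the same at every admissible time; this is why the law of
  the height at time \<open>N\<close> is exactly \<open>rho_ev\<close>, and not only in the limit, on the even heights
  below \<open>N - k\<close> when \<open>k + N\<close> is even (\<open>walk_prob_stationary\<close>). A forward walk is seen above \<open>N - k\<close> only during its
  initial excursion, which makes at most one turn (\<open>walk_prob_Fwd_single_turn\<close>); this explicit
  case starts the induction.

  Three facts about the tree reduce the count of descendants to this walk.

  Neighbours (\<open>neighbours\<close>). The sublattices of \<open>u \<O> \<oplus> \<O>\<close> with quotient the residue field are
  the kernels of the nonzero functionals on its reduction, one for each point of the projective
  line over the finite field. One point gives the vertex above; the others are shears of a
  diagonal lattice, and since the shear is a polynomial matrix their heights can be read off.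

  Heights (\<open>orbit_height_tri\<close>, \<open>orbit_height_unique\<close>). Every lattice has a triangular basis;
  the Euclidean algorithm, played with polynomial row operations, shrinks the gap between the two
  diagonal valuations until the basis is diagonal. Conversely an invertible polynomial matrix cannot
  move one ray vertex to another, because nonzero polynomials in \<open>t\<close> have valuation at most 0.

  Absence of circuits (\<open>tree_path_first_step_unique\<close>). A non-backtracking path lifts to a
  descending chain of lattices \<open>L\<^sub>0 \<supset> L\<^sub>1 \<supset> \<dots>\<close>, and \<open>L\<^sub>1\<close> is recovered from the end of the chain as
  \<open>L\<^sub>n + \<pi> L\<^sub>0\<close>. So the descendant sets through distinct neighbours are disjoint and
  their cardinalities add up.
\<close>

section \<open>The ring of integers\<close>

(* The dollar sign denotes vector components throughout. *)
no_notation fps_nth (infixl \<open>$\<close> 75)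
notation fls_nth (infixl \<open>$$\<close> 75)

definition \<O> :: "'a::field fls set" where "\<O> = range fps_to_fls"

lemma integers_iff_subdegree: "x \<in> \<O> \<longleftrightarrow> 0 \<le> fls_subdegree x"
proof
  assume "0 \<le> fls_subdegree x"
  then have "x = fps_to_fls (fls_regpart x)"
    by (intro fls_eqI) auto
  then show "x \<in> \<O>" by (auto simp: \<O>_def)
qed (auto simp: \<O>_def fls_subdegree_fls_to_fps_gt0)

lemma integers_closed [intro, simp]:
  fixes x y :: "'a::field fls"
  shows "(0 :: 'a fls) \<in> \<O>" and "(1 :: 'a fls) \<in> \<O>"
    and "(fls_X :: 'a fls) \<in> \<O>" and "fls_const c \<in> (\<O> :: 'a fls set)"
    and "fps_to_fls p \<in> (\<O> :: 'a fls set)"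
    and "x \<in> \<O> \<Longrightarrow> - x \<in> \<O>"
    and "x \<in> \<O> \<Longrightarrow> y \<in> \<O> \<Longrightarrow> x + y \<in> \<O>"
    and "x \<in> \<O> \<Longrightarrow> y \<in> \<O> \<Longrightarrow> x - y \<in> \<O>"
    and "x \<in> \<O> \<Longrightarrow> y \<in> \<O> \<Longrightarrow> x * y \<in> \<O>"
proof -
  show "(0 :: 'a fls) \<in> \<O>" "(1 :: 'a fls) \<in> \<O>"
    "(fls_X :: 'a fls) \<in> \<O>" "fls_const c \<in> (\<O> :: 'a fls set)"
    "fps_to_fls p \<in> (\<O> :: 'a fls set)"
    "x \<in> \<O> \<Longrightarrow> - x \<in> \<O>"
    by (simp_all add: integers_iff_subdegree fls_subdegree_fls_to_fps_gt0)
  show "x + y \<in> \<O>" if "x \<in> \<O>" "y \<in> \<O>"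
    using that by (force simp: \<O>_def simp flip: fps_to_fls_plus)
  show "x - y \<in> \<O>" if "x \<in> \<O>" "y \<in> \<O>"
    using that by (force simp: \<O>_def simp flip: fps_to_fls_minus)
  show "x * y \<in> \<O>" if "x \<in> \<O>" "y \<in> \<O>"
    using that by (force simp: \<O>_def simp flip: fls_times_fps_to_fls)
qed

lemma divide_mem_integers_iff:
  assumes "y \<noteq> 0"
  shows "x / y \<in> \<O> \<longleftrightarrow> x = 0 \<or> fls_subdegree y \<le> fls_subdegree x"
  using assms by (cases "x = 0") (auto simp: integers_iff_subdegree fls_divide_subdegree)

section \<open>Lattices\<close>

lemma vector_2_eq_iff: "(x :: 'a ^ 2) = y \<longleftrightarrow> x $ 1 = y $ 1 \<and> x $ 2 = y $ 2"
  by (simp add: vec_eq_iff forall_2)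

lemma mem_standard_lattice: "x \<in> standard_lattice \<longleftrightarrow> x $ 1 \<in> \<O> \<and> x $ 2 \<in> \<O>"
  by (simp add: standard_lattice_def \<O>_def forall_2)

lemma standard_lattice_eq_span:
  "standard_lattice = O_mod.span {vector [1, 0], vector [0, 1] :: 'a::field fls ^ 2}"
proof
  show "standard_lattice \<subseteq> O_mod.span {vector [1, 0], vector [0, 1] :: 'a fls ^ 2}"
  proof
    fix x :: "'a fls ^ 2" assume "x \<in> standard_lattice"
    then obtain a b where "x $ 1 = fps_to_fls a" "x $ 2 = fps_to_fls b"
      by (auto simp: mem_standard_lattice \<O>_def)
    then have "x = O_scale a (vector [1, 0]) + O_scale b (vector [0, 1])"
      by (simp add: vector_2_eq_iff O_scale_def)
    then show "x \<in> O_mod.span {vector [1, 0], vector [0, 1]}"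
      by (auto intro!: O_mod.span_add O_mod.span_scale intro: O_mod.span_base)
  qed
  have "O_mod.subspace (standard_lattice :: ('a fls ^ 2) set)"
    by (auto simp: O_mod.subspace_def mem_standard_lattice O_scale_def)
  then show "O_mod.span {vector [1, 0], vector [0, 1] :: 'a fls ^ 2} \<subseteq> standard_lattice"
    by (intro O_mod.span_minimal) (auto simp: mem_standard_lattice)
qed

text \<open>Homotheties and matrices act on lattices in the same way, so invariance of the lattice
notions is shown once, for every linear bijection.\<close>

definition linear_iso :: "('a::field fls ^ 2 \<Rightarrow> 'a fls ^ 2) \<Rightarrow> bool" where
  "linear_iso g \<longleftrightarrow> Vector_Spaces.linear (*s) (*s) g \<and> bij g"

lemma linear_iso_add: "linear_iso g \<Longrightarrow> g (x + y) = g x + g y"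
  and linear_iso_scale: "linear_iso g \<Longrightarrow> g (c *s x) = c *s g x"
  and linear_iso_bij: "linear_iso g \<Longrightarrow> bij g"
  and linear_iso_inj: "linear_iso g \<Longrightarrow> inj g"
  by (auto simp: linear_iso_def vec.linear_add vec.linear_scale bij_is_inj)

lemma linear_iso_image_scale: "linear_iso g \<Longrightarrow> g ` (*s) c ` L = (*s) c ` g ` L"
  by (simp add: image_image linear_iso_scale)

lemma linear_iso_scaling: "c \<noteq> 0 \<Longrightarrow> linear_iso ((*s) c)"
  unfolding linear_iso_def
  by (auto intro!: vec.linear_scale_self bij_betw_byWitness[where f' = "(*s) (inverse c)"])

lemma linear_iso_matrix: "invertible A \<Longrightarrow> linear_iso ((*v) A)"
  unfolding linear_iso_def invertible_def
proof
  assume "\<exists>B. A ** B = mat 1 \<and> B ** A = mat 1"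
  then obtain B where "A ** B = mat 1" "B ** A = mat 1" by blast
  then show "bij ((*v) A)"
    by (intro o_bij[of "(*v) B"]) (auto simp: fun_eq_iff matrix_vector_mul_assoc)
qed auto

lemma is_lattice_image:
  assumes g: "linear_iso g" and L: "is_lattice L"
  shows "is_lattice (g ` L)"
proof -
  interpret module_hom O_scale O_scale g
    by unfold_locales (use g in \<open>auto simp: linear_iso_add linear_iso_scale O_scale_def\<close>)
  from L obtain S where S: "finite S" "L = O_mod.span S" "vec.span L = UNIV"
    by (auto simp: is_lattice_def)
  have "g ` L = O_mod.span (g ` S)"
    by (simp add: span_image S)
  moreover have "vec.span (g ` L) = g ` UNIV"
    using g S vec.linear_span_image[of g L] by (simp add: linear_iso_def)
  moreover have "g ` UNIV = UNIV"
    using g by (simp add: linear_iso_def bij_is_surj)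
  ultimately show ?thesis
    using S unfolding is_lattice_def by (metis finite_imageI)
qed

lemma is_lattice_standard: "is_lattice (standard_lattice :: ('a::field fls ^ 2) set)"
proof -
  have "x \<in> vec.span (standard_lattice :: ('a fls ^ 2) set)" for x
  proof -
    have "x = x $ 1 *s vector [1, 0] + x $ 2 *s vector [0, 1]"
      by (simp add: vector_2_eq_iff)
    moreover have "vector [1, 0] \<in> (standard_lattice :: ('a fls ^ 2) set)"
      "vector [0, 1] \<in> (standard_lattice :: ('a fls ^ 2) set)"
      by (auto simp: mem_standard_lattice)
    ultimately show ?thesis
      using vec.span_add[OF vec.span_scale[OF vec.span_base] vec.span_scale[OF vec.span_base]]
      by metis
  qed
  then show ?thesis
    unfolding is_lattice_def
    by (auto intro!: exI[of _ "{vector [1, 0], vector [0, 1]}"] simp: standard_lattice_eq_span)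
qed

lemma lattice_closed:
  assumes "is_lattice L"
  shows lattice_zero: "0 \<in> L"
    and lattice_add: "x \<in> L \<Longrightarrow> y \<in> L \<Longrightarrow> x + y \<in> L"
    and lattice_diff: "x \<in> L \<Longrightarrow> y \<in> L \<Longrightarrow> x - y \<in> L"
    and lattice_scale: "a \<in> \<O> \<Longrightarrow> x \<in> L \<Longrightarrow> a *s x \<in> L"
  using assms by (auto simp: \<O>_def is_lattice_def O_mod.span_zero O_mod.span_add O_mod.span_diff
      O_mod.span_scale simp flip: O_scale_def)

text \<open>Upper triangular matrices serve three purposes: their columns are normal forms of bases,
\<open>tri 1 p 1\<close> is a shear, and \<open>tri u 0 w\<close> spans the lattice \<open>u \<O> \<oplus> w \<O>\<close>.\<close>

definition tri :: "'a::field fls \<Rightarrow> 'a fls \<Rightarrow> 'a fls \<Rightarrow> 'a fls ^ 2 ^ 2" where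
  "tri u x w = vector [vector [u, x], vector [0, w]]"

abbreviation swap :: "'a::field fls ^ 2 ^ 2" where
  "swap \<equiv> vector [vector [0, 1], vector [1, 0]]"

lemma tri_nth [simp]: "tri u x w $ 1 $ 1 = u" "tri u x w $ 1 $ 2 = x"
  "tri u x w $ 2 $ 1 = 0" "tri u x w $ 2 $ 2 = w"
  by (simp_all add: tri_def)

lemma matrix_vector_mult_2: "(A *v x) $ i = A $ i $ 1 * x $ 1 + A $ i $ (2::2) * x $ 2"
  by (simp add: matrix_vector_mult_def sum_2)

lemma matrix_matrix_mult_2: "(A ** B) $ i $ j = A $ i $ 1 * B $ 1 $ j + A $ i $ (2::2) * B $ 2 $ j"
  by (simp add: matrix_matrix_mult_def sum_2)

lemma matrix_2_eq_iff: "(A :: 'a ^ 2 ^ 2) = B \<longleftrightarrow>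
    A $ 1 $ 1 = B $ 1 $ 1 \<and> A $ 1 $ 2 = B $ 1 $ 2 \<and> A $ 2 $ 1 = B $ 2 $ 1 \<and> A $ 2 $ 2 = B $ 2 $ 2"
  by (auto simp: vec_eq_iff forall_2)

lemma mat_2_nth [simp]: "(mat a :: 'a::zero^2^2) $ 1 $ 1 = a" "(mat a :: 'a^2^2) $ 2 $ 2 = a"
  "(mat a :: 'a^2^2) $ 1 $ 2 = 0" "(mat a :: 'a^2^2) $ 2 $ 1 = 0"
  by (simp_all add: mat_def)

lemma tri_mult: "tri u x w ** tri u' x' w' = tri (u * u') (u * x' + x * w') (w * w')"
  by (simp add: matrix_2_eq_iff matrix_matrix_mult_2)

lemma tri_1: "tri 1 0 1 = mat 1"
  by (simp add: matrix_2_eq_iff)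

lemma invertible_tri: "u \<noteq> 0 \<Longrightarrow> w \<noteq> 0 \<Longrightarrow> invertible (tri u x w)"
  unfolding invertible_def
  by (intro exI[of _ "tri (inverse u) (- x / (u * w)) (inverse w)"])
     (simp add: tri_mult field_simps tri_1)

lemma linear_iso_tri: "u \<noteq> 0 \<Longrightarrow> w \<noteq> 0 \<Longrightarrow> linear_iso ((*v) (tri u x w))"
  by (simp add: linear_iso_matrix invertible_tri)

lemma tri_apply: "tri u x w *v v = vector [u * v $ 1 + x * v $ 2, w * v $ 2]"
  by (simp add: vector_2_eq_iff matrix_vector_mult_2)

abbreviation tri_lattice where "tri_lattice u x w \<equiv> (*v) (tri u x w) ` standard_lattice"

lemma mem_tri_lattice:
  fixes v :: "'a::field fls ^ 2"
  shows "v \<in> tri_lattice u x w \<longleftrightarrow> (\<exists>a\<in>\<O>. \<exists>b\<in>\<O>. v = vector [u * a + x * b, w * b])"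
proof
  assume "v \<in> tri_lattice u x w"
  then obtain y where "y \<in> standard_lattice" "v = tri u x w *v y"
    by blast
  then show "\<exists>a\<in>\<O>. \<exists>b\<in>\<O>. v = vector [u * a + x * b, w * b]"
    by (intro bexI[of _ "y $ 1"] bexI[of _ "y $ 2"]) (auto simp: tri_apply mem_standard_lattice)
next
  assume "\<exists>a\<in>\<O>. \<exists>b\<in>\<O>. v = vector [u * a + x * b, w * b]"
  then obtain a b where "a \<in> \<O>" "b \<in> \<O>" "v = tri u x w *v vector [a, b]"
    by (auto simp: tri_apply)
  then show "v \<in> tri_lattice u x w"
    by (auto simp: mem_standard_lattice)
qed

lemma mem_diag_lattice:
  assumes "u \<noteq> 0" "w \<noteq> 0"
  shows "v \<in> tri_lattice u 0 w \<longleftrightarrow> v $ 1 / u \<in> \<O> \<and> v $ 2 / w \<in> \<O>"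
proof
  assume *: "v $ 1 / u \<in> \<O> \<and> v $ 2 / w \<in> \<O>"
  have "v = vector [u * (v $ 1 / u) + 0 * (v $ 2 / w), w * (v $ 2 / w)]"
    using assms by (simp add: vector_2_eq_iff)
  then show "v \<in> tri_lattice u 0 w"
    unfolding mem_tri_lattice using * by blast
qed (use assms in \<open>auto simp: mem_tri_lattice\<close>)

lemma scale_tri_lattice: "(*s) c ` tri_lattice u x w = tri_lattice (c * u) (c * x) (c * w)"
proof -
  have "c *s (tri u x w *v v) = tri (c * u) (c * x) (c * w) *v v" for v
    by (simp add: tri_apply vector_2_eq_iff algebra_simps)
  then show ?thesis by (simp add: image_image)
qed

lemma is_lattice_tri: "u \<noteq> 0 \<Longrightarrow> w \<noteq> 0 \<Longrightarrow> is_lattice (tri_lattice u x w)"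
  by (intro is_lattice_image linear_iso_tri is_lattice_standard)

text \<open>In a discrete valuation ring, divisibility is a total preorder, so some generator divides
all the others in a given coordinate.\<close>

lemma coordinate_dominant:
  fixes S :: "('a::field fls ^ 2) set"
  assumes "finite S" "S \<noteq> {}"
  shows "\<exists>s\<in>S. \<forall>r\<in>S. \<exists>a\<in>\<O>. r $ i = a * s $ i"
proof (cases "\<forall>r\<in>S. r $ i = 0")
  case True
  then show ?thesis using assms by force
next
  case False
  define T where "T = {r \<in> S. r $ i \<noteq> 0}"
  have "finite T" "T \<noteq> {}" using False assms by (auto simp: T_def)
  then obtain s where s: "s \<in> T" "\<And>r. r \<in> T \<Longrightarrow> fls_subdegree (s $ i) \<le> fls_subdegree (r $ i)"
    using arg_min_if_finite[of T "\<lambda>r. fls_subdegree (r $ i)"] by (metis leI)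
  have "\<exists>a\<in>\<O>. r $ i = a * s $ i" if "r \<in> S" for r
    using s that by (intro bexI[of _ "r $ i / s $ i"]) (auto simp: divide_mem_integers_iff T_def)
  then show ?thesis using s by (auto simp: T_def)
qed

text \<open>Gaussian elimination over the discrete valuation ring \<open>\<O>\<close>. A generator whose second
coordinate has least valuation clears the second coordinates of the others; of the resulting
vectors on the first axis, the one with least valuation generates the rest. The diagonal entries
are nonzero because the lattice spans the plane.\<close>

lemma lattice_triangular:
  assumes "is_lattice (L :: ('a::field fls ^ 2) set)"
  obtains u x w where "u \<noteq> 0" "w \<noteq> 0" "L = tri_lattice u x w"
proof -
  from assms obtain S where S: "finite S" "L = O_mod.span S" "vec.span L = UNIV"
    by (auto simp: is_lattice_def)
  have "vector [1, 0] \<noteq> (0 :: 'a fls ^ 2)"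
    by (simp add: vector_2_eq_iff)
  moreover have "L = {0}" if "S = {}"
    using S(2) that by simp
  ultimately have "S \<noteq> {}"
    using S(3) by (metis UNIV_I singletonD vec.span_empty vec.span_insert_0)
  then obtain s where s: "s \<in> S" "\<And>r. r \<in> S \<Longrightarrow> \<exists>a\<in>\<O>. r $ 2 = a * s $ 2"
    using coordinate_dominant[of S 2] S(1) by blast
  define elim where "elim r = r - (r $ 2 / s $ 2) *s s" for r
  from coordinate_dominant[of "elim ` S" 1] obtain e where e: "e \<in> elim ` S"
      "\<And>r. r \<in> elim ` S \<Longrightarrow> \<exists>a\<in>\<O>. r $ 1 = a * e $ 1"
    using \<open>S \<noteq> {}\<close> S(1) by blast
  have coeff: "r $ 2 / s $ 2 \<in> \<O>" and elim2: "elim r $ 2 = 0" if "r \<in> S" for r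
    using s(2)[OF that] by (auto simp: elim_def)
  define u x w where "u = e $ 1" and "x = s $ 1" and "w = s $ 2"
  have e2: "e = vector [u, 0]"
    using e(1) elim2 by (auto simp: vector_2_eq_iff u_def)
  have sx: "s = vector [x, w]"
    by (simp add: vector_2_eq_iff x_def w_def)
  have sub: "O_mod.subspace (tri_lattice u x w)"
    unfolding standard_lattice_eq_span
    using module_hom.subspace_image[of O_scale O_scale "(*v) (tri u x w)"
        "O_mod.span {vector [1, 0], vector [0, 1]}"]
    by (simp add: module_hom_iff O_mod.module_axioms O_scale_def matrix_vector_right_distrib
        vector_scalar_commute)
  have L: "L = tri_lattice u x w"
  proof
    have "r \<in> tri_lattice u x w" if r: "r \<in> S" for r
    proof -
      obtain a where a: "a \<in> \<O>" "elim r $ 1 = a * u"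
        using e(2)[OF imageI[OF r]] unfolding u_def by blast
      have "elim r = vector [a * u, 0]"
        using a elim2[OF r] by (simp add: vector_2_eq_iff)
      moreover have "r = elim r + (r $ 2 / s $ 2) *s s"
        by (simp add: elim_def)
      moreover define b where "b = r $ 2 / s $ 2"
      ultimately have "r = vector [u * a + x * b, w * b]"
        by (simp add: vector_2_eq_iff x_def w_def algebra_simps)
      then show ?thesis
        using a(1) coeff[OF r] unfolding mem_tri_lattice b_def by blast
    qed
    then show "L \<subseteq> tri_lattice u x w"
      unfolding S(2) by (intro O_mod.span_minimal sub subsetI)
    have "s \<in> L" using s S O_mod.span_base by blast
    moreover from e(1) obtain r where "r \<in> S" "e = elim r" by blast
    ultimately have "e \<in> L"
      unfolding elim_def using coeff assms S(2)
      by (metis lattice_diff lattice_scale O_mod.span_base)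
    have "vector [u * a + x * b, w * b] \<in> L" if "a \<in> \<O>" "b \<in> \<O>" for a b
    proof -
      have "vector [u * a + x * b, w * b] = a *s e + b *s s"
        by (simp add: vector_2_eq_iff e2 sx algebra_simps)
      then show ?thesis
        using \<open>s \<in> L\<close> \<open>e \<in> L\<close> assms that by (simp add: lattice_add lattice_scale)
    qed
    then show "tri_lattice u x w \<subseteq> L"
      unfolding subset_iff mem_tri_lattice by blast
  qed
  have w: "w \<noteq> 0"
  proof
    assume "w = 0"
    then have "L \<subseteq> {v. v $ 2 = 0}"
      unfolding L by (auto simp: tri_apply)
    moreover have "vec.subspace {v :: 'a fls ^ 2. v $ 2 = 0}"
      by (auto simp: vec.subspace_def)
    ultimately have "vec.span L \<subseteq> {v. v $ 2 = 0}"
      by (rule vec.span_minimal)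
    then have "UNIV \<subseteq> {v :: 'a fls ^ 2. v $ 2 = 0}"
      using S(3) by simp
    then have "(vector [0, 1] :: 'a fls ^ 2) $ 2 = 0" by blast
    then show False by simp
  qed
  have "u \<noteq> 0"
  proof
    assume "u = 0"
    then have "L \<subseteq> {v. v $ 1 * w = v $ 2 * x}"
      unfolding L by (auto simp: tri_apply)
    moreover have "vec.subspace {v :: 'a fls ^ 2. v $ 1 * w = v $ 2 * x}"
      by (auto simp: vec.subspace_def algebra_simps)
    ultimately have "vec.span L \<subseteq> {v. v $ 1 * w = v $ 2 * x}"
      by (rule vec.span_minimal)
    then have "UNIV \<subseteq> {v :: 'a fls ^ 2. v $ 1 * w = v $ 2 * x}"
      using S(3) by simp
    then have "(vector [1, 0] :: 'a fls ^ 2) $ 1 * w = (vector [1, 0] :: 'a fls ^ 2) $ 2 * x" by blast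
    with w show False by simp
  qed
  with w L show ?thesis using that by blast
qed

lemma lattice_iso_standard:
  assumes "is_lattice (L :: ('a::field fls ^ 2) set)"
  obtains g where "linear_iso g" "L = g ` standard_lattice"
  using lattice_triangular[OF assms] linear_iso_tri by metis

section \<open>Adjacency of lattices\<close>

lemma integers_nth_0_mult: "x \<in> \<O> \<Longrightarrow> y \<in> \<O> \<Longrightarrow> (x * y) $$ 0 = x $$ 0 * y $$ 0"
  by (auto simp: \<O>_def simp flip: fls_times_fps_to_fls)

text \<open>The maximal ideal: divisibility by the uniformizer is the vanishing of the constant
coefficient, which makes membership in a sublattice a condition on residues.\<close>

lemma divide_X_mem_integers_iff:
  fixes x :: "'a::field fls"
  shows "x / fls_X \<in> \<O> \<longleftrightarrow> x \<in> \<O> \<and> x $$ 0 = 0"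
proof -
  have "0 < fls_subdegree x \<longleftrightarrow> 0 \<le> fls_subdegree x \<and> x $$ 0 = 0" if "x \<noteq> 0"
    using that nth_fls_subdegree_nonzero[of x] fls_eq0_below_subdegree[of 0 x]
    by (smt (verit) not_le)
  moreover have "fls_X \<noteq> (0 :: 'a fls)" by simp
  ultimately show ?thesis
    by (cases "x = 0") (simp_all add: divide_mem_integers_iff integers_iff_subdegree int_one_le_iff_zero_less)
qed

definition lattice_adj :: "('a::field fls ^ 2) set \<Rightarrow> ('a fls ^ 2) set \<Rightarrow> bool" where
  "lattice_adj L L' \<longleftrightarrow> is_lattice L \<and> is_lattice L' \<and>
     (*s) fls_X ` L \<subset> L' \<and> L' \<subset> L \<and> quotient_iso_residue L L'"

lemma tree_adj_iff: "tree_adj v w \<longleftrightarrow>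
    (\<exists>L L'. lattice_adj L L' \<and> v = homothety_class L \<and> w = homothety_class L')"
  unfolding tree_adj_def lattice_adj_def by auto

text \<open>The functional that exhibits the quotient as the residue field, with scalars taken in
\<open>\<O>\<close> instead of in the type of formal power series.\<close>

definition residue_map :: "('a::field fls ^ 2 \<Rightarrow> 'a) \<Rightarrow> ('a fls ^ 2) set \<Rightarrow> ('a fls ^ 2) set \<Rightarrow> bool" where
  "residue_map \<phi> L L' \<longleftrightarrow> (\<forall>x\<in>L. \<forall>y\<in>L. \<phi> (x + y) = \<phi> x + \<phi> y) \<and>
     (\<forall>a\<in>\<O>. \<forall>x\<in>L. \<phi> (a *s x) = a $$ 0 * \<phi> x) \<and>
     \<phi> ` L = UNIV \<and> (\<forall>x. x \<in> L' \<longleftrightarrow> x \<in> L \<and> \<phi> x = 0)"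

lemma quotient_iso_residue_iff:
  fixes L :: "('a::field fls ^ 2) set"
  shows "quotient_iso_residue L L' \<longleftrightarrow> (\<exists>\<phi>. residue_map \<phi> L L')"
proof -
  have "{x \<in> L. \<phi> x = 0} = L' \<longleftrightarrow> (\<forall>x. x \<in> L' \<longleftrightarrow> x \<in> L \<and> \<phi> x = 0)" for \<phi> :: "'a fls ^ 2 \<Rightarrow> 'a"
    by auto
  then show ?thesis
    unfolding quotient_iso_residue_def residue_map_def O_scale_def \<O>_def by simp
qed

lemma residue_mapD:
  assumes "residue_map \<phi> L L'"
  shows "x \<in> L \<Longrightarrow> y \<in> L \<Longrightarrow> \<phi> (x + y) = \<phi> x + \<phi> y"
    and "a \<in> \<O> \<Longrightarrow> x \<in> L \<Longrightarrow> \<phi> (a *s x) = a $$ 0 * \<phi> x"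
    and "\<phi> ` L = UNIV" and "x \<in> L' \<longleftrightarrow> x \<in> L \<and> \<phi> x = 0"
  using assms by (simp_all add: residue_map_def)

lemma lattice_adj_image:
  assumes g: "linear_iso g" and adj: "lattice_adj L L'"
  shows "lattice_adj (g ` L) (g ` L')"
proof -
  have inj: "inj g" using g by (rule linear_iso_inj)
  obtain \<phi> where "residue_map \<phi> L L'"
    using adj by (auto simp: lattice_adj_def quotient_iso_residue_iff)
  note \<phi> = residue_mapD[OF this]
  have [simp]: "inv g (g x + g y) = x + y" "inv g (a *s g x) = a *s x" "inv g (g x) = x" for x y a
    using inj by (simp_all add: g inv_f_f flip: linear_iso_add linear_iso_scale)
  have "residue_map (\<phi> \<circ> inv g) (g ` L) (g ` L')"
    unfolding residue_map_def using \<phi> by (auto simp: image_image)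
  then have "quotient_iso_residue (g ` L) (g ` L')"
    unfolding quotient_iso_residue_iff by blast
  then show ?thesis
    using adj g inj unfolding lattice_adj_def
    by (simp add: is_lattice_image psubset_eq inj_image_subset_iff inj_image_eq_iff
        flip: linear_iso_image_scale)
qed

lemma lattice_adj_image_iff:
  assumes g: "linear_iso g"
  shows "lattice_adj (g ` L) (g ` L') \<longleftrightarrow> lattice_adj L L'"
proof
  have bij: "bij g" using g by (rule linear_iso_bij)
  have inv: "linear_iso (inv g)"
    unfolding linear_iso_def
  proof
    show "bij (inv g)" using bij by (rule bij_imp_bij_inv)
    have "inv g (x + y) = inv g x + inv g y" "inv g (c *s x) = c *s inv g x" for x y c
      using bij linear_iso_add[OF g, of "inv g x" "inv g y"] linear_iso_scale[OF g, of c "inv g x"]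
      by (metis bij_inv_eq_iff)+
    then show "Vector_Spaces.linear (*s) (*s) (inv g)"
      by (intro Vector_Spaces.linear_iff[THEN iffD2]) (auto simp: vec.vector_space_axioms)
  qed
  assume "lattice_adj (g ` L) (g ` L')"
  from lattice_adj_image[OF inv this] show "lattice_adj L L'"
    using bij by (simp add: image_image bij_is_inj inv_f_f)
qed (rule lattice_adj_image[OF g])

text \<open>The functionals are the residues of the two coordinates of a vector with respect to the
diagonal basis.\<close>

lemma lattice_adj_diag:
  fixes u w :: "'a::field fls"
  assumes u: "u \<noteq> 0" and w: "w \<noteq> 0"
  shows lattice_adj_diag1: "lattice_adj (tri_lattice u 0 w) (tri_lattice (fls_X * u) 0 w)"
    and lattice_adj_diag2: "lattice_adj (tri_lattice u 0 w) (tri_lattice u 0 (fls_X * w))"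
proof -
  have Xu: "fls_X * u \<noteq> 0" and Xw: "fls_X * w \<noteq> 0" using u w by auto
  have div: "y / (fls_X * z) \<in> \<O> \<longleftrightarrow> y / z \<in> \<O> \<and> (y / z) $$ 0 = 0" for y z :: "'a fls"
    unfolding divide_X_mem_integers_iff[symmetric] by (simp only: divide_divide_eq_left mult.commute)
  have sub: "tri_lattice (fls_X * u) 0 w \<subseteq> tri_lattice u 0 w"
      "tri_lattice u 0 (fls_X * w) \<subseteq> tri_lattice u 0 w"
      "tri_lattice (fls_X * u) 0 (fls_X * w) \<subseteq> tri_lattice (fls_X * u) 0 w"
      "tri_lattice (fls_X * u) 0 (fls_X * w) \<subseteq> tri_lattice u 0 (fls_X * w)"
    unfolding subset_iff using u w Xu Xw by (simp_all add: mem_diag_lattice div)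
  have e: "vector [u, 0] \<in> tri_lattice u 0 w" "vector [u, 0] \<notin> tri_lattice (fls_X * u) 0 w"
    "vector [u, 0] \<in> tri_lattice u 0 (fls_X * w)"
    "vector [u, 0] \<notin> tri_lattice (fls_X * u) 0 (fls_X * w)"
    "vector [0, w] \<in> tri_lattice u 0 w" "vector [0, w] \<notin> tri_lattice u 0 (fls_X * w)"
    "vector [0, w] \<in> tri_lattice (fls_X * u) 0 w"
    "vector [0, w] \<notin> tri_lattice (fls_X * u) 0 (fls_X * w)"
    using u w Xu Xw by (simp_all add: mem_diag_lattice div) (simp_all add: integers_iff_subdegree)
  have 1: "quotient_iso_residue (tri_lattice u 0 w) (tri_lattice (fls_X * u) 0 w)"
    unfolding quotient_iso_residue_iff residue_map_def
  proof (intro exI[of _ "\<lambda>x. (x $ 1 / u) $$ 0"] conjI ballI allI)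
    show "x \<in> tri_lattice (fls_X * u) 0 w \<longleftrightarrow> x \<in> tri_lattice u 0 w \<and> (x $ 1 / u) $$ 0 = 0" for x
      by (simp only: mem_diag_lattice[OF u w] mem_diag_lattice[OF Xu w] div) blast
    have "vector [u * fls_const c, 0] \<in> tri_lattice u 0 w" for c
      using u w by (simp add: mem_diag_lattice)
    then have "c \<in> (\<lambda>x. (x $ 1 / u) $$ 0) ` tri_lattice u 0 w" for c
      using u by - (rule rev_image_eqI[of "vector [u * fls_const c, 0]"]; simp)
    then show "(\<lambda>x. (x $ 1 / u) $$ 0) ` tri_lattice u 0 w = UNIV"
      by blast
    show "((a *s x) $ 1 / u) $$ 0 = a $$ 0 * (x $ 1 / u) $$ 0"
      if "a \<in> \<O>" "x \<in> tri_lattice u 0 w" for a x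
      using that u w integers_nth_0_mult[of a "x $ 1 / u"]
      by (simp add: mem_diag_lattice)
  qed (simp add: add_divide_distrib)
  have 2: "quotient_iso_residue (tri_lattice u 0 w) (tri_lattice u 0 (fls_X * w))"
    unfolding quotient_iso_residue_iff residue_map_def
  proof (intro exI[of _ "\<lambda>x. (x $ 2 / w) $$ 0"] conjI ballI allI)
    show "x \<in> tri_lattice u 0 (fls_X * w) \<longleftrightarrow> x \<in> tri_lattice u 0 w \<and> (x $ 2 / w) $$ 0 = 0" for x
      by (simp only: mem_diag_lattice[OF u w] mem_diag_lattice[OF u Xw] div) blast
    have "vector [0, w * fls_const c] \<in> tri_lattice u 0 w" for c
      using u w by (simp add: mem_diag_lattice)
    then have "c \<in> (\<lambda>x. (x $ 2 / w) $$ 0) ` tri_lattice u 0 w" for c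
      using w by - (rule rev_image_eqI[of "vector [0, w * fls_const c]"]; simp)
    then show "(\<lambda>x. (x $ 2 / w) $$ 0) ` tri_lattice u 0 w = UNIV"
      by blast
    show "((a *s x) $ 2 / w) $$ 0 = a $$ 0 * (x $ 2 / w) $$ 0"
      if "a \<in> \<O>" "x \<in> tri_lattice u 0 w" for a x
      using that u w integers_nth_0_mult[of a "x $ 2 / w"]
      by (simp add: mem_diag_lattice)
  qed (simp add: add_divide_distrib)
  show "lattice_adj (tri_lattice u 0 w) (tri_lattice (fls_X * u) 0 w)"
    "lattice_adj (tri_lattice u 0 w) (tri_lattice u 0 (fls_X * w))"
    unfolding lattice_adj_def scale_tri_lattice mult_zero_right
    using 1 2 sub e is_lattice_tri[OF u w] is_lattice_tri[OF Xu w] is_lattice_tri[OF u Xw]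
    by (simp_all only: psubset_eq) blast+
qed

text \<open>A functional on \<open>u \<O> \<oplus> \<O>\<close> is determined by its values \<open>\<alpha>\<close> and \<open>\<beta>\<close> on the two basis
vectors, and its kernel depends only on the ratio: it is the diagonal sublattice if \<open>\<alpha> = 0\<close>, and
otherwise the sublattice of residue equation \<open>a = c b\<close> with \<open>c = - \<beta> / \<alpha>\<close>.\<close>

lemma lattice_adj_diag_cases:
  fixes u :: "'a::field fls"
  assumes u: "u \<noteq> 0" and adj: "lattice_adj (tri_lattice u 0 1) L"
  shows "L = tri_lattice u 0 fls_X \<or> (\<exists>c. L = tri_lattice (fls_X * u) (fls_const c * u) 1)"
proof -
  let ?L = "tri_lattice u 0 1" and ?e = "vector [u, 0] :: 'a fls ^ 2"
  let ?f = "vector [0, 1] :: 'a fls ^ 2"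
  obtain \<phi> where "residue_map \<phi> ?L L"
    using adj by (auto simp: lattice_adj_def quotient_iso_residue_iff)
  note \<phi> = residue_mapD[OF this]
  have lat: "is_lattice ?L" using u by (simp add: is_lattice_tri)
  have ef: "?e \<in> ?L" "?f \<in> ?L"
    using u by (simp_all add: mem_diag_lattice)
  have val: "\<phi> (vector [u * a, b]) = a $$ 0 * \<phi> ?e + b $$ 0 * \<phi> ?f" if "a \<in> \<O>" "b \<in> \<O>" for a b
  proof -
    have "vector [u * a, b] = a *s ?e + b *s ?f"
      by (simp add: vector_2_eq_iff)
    then show ?thesis
      using that ef lat by (simp add: \<phi> lattice_scale)
  qed
  have memL: "x \<in> L \<longleftrightarrow> (\<exists>a\<in>\<O>. \<exists>b\<in>\<O>. x = vector [u * a, b] \<and>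
      a $$ 0 * \<phi> ?e + b $$ 0 * \<phi> ?f = 0)" for x
  proof -
    have "x \<in> ?L \<longleftrightarrow> (\<exists>a\<in>\<O>. \<exists>b\<in>\<O>. x = vector [u * a, b])"
      by (simp only: mem_tri_lattice mult_zero_left add_0_right mult_1_left)
    then show ?thesis
      unfolding \<phi>(4) by (metis val)
  qed
  show ?thesis
  proof (cases "\<phi> ?e = 0")
    case True
    have "\<phi> ?f \<noteq> 0"
    proof
      assume "\<phi> ?f = 0"
      with True have "\<phi> x = 0" if "x \<in> ?L" for x
        using that val unfolding mem_tri_lattice by auto
      moreover obtain x where "x \<in> ?L" "\<phi> x = 1"
        using \<phi>(3) by (metis UNIV_I imageE)
      ultimately show False by simp
    qed
    with True have "x \<in> L \<longleftrightarrow> x \<in> tri_lattice u 0 fls_X" for x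
      unfolding memL mem_diag_lattice[OF u fls_X_nonzero] divide_X_mem_integers_iff
      using u by (auto simp: vector_2_eq_iff intro!: bexI[of _ "x $ 1 / u"])
    then show ?thesis by blast
  next
    case False
    define c where "c = - \<phi> ?f / \<phi> ?e"
    have c: "a $$ 0 * \<phi> ?e + b $$ 0 * \<phi> ?f = 0 \<longleftrightarrow> a $$ 0 = c * b $$ 0" for a b :: "'a fls"
    proof -
      have "a $$ 0 = c * b $$ 0 \<longleftrightarrow> a $$ 0 * \<phi> ?e = c * \<phi> ?e * b $$ 0"
        using False by (auto simp: mult.commute mult.left_commute)
      then show ?thesis
        using False by (simp add: c_def eq_neg_iff_add_eq_0 mult.commute)
    qed
    have "x \<in> L \<longleftrightarrow> x \<in> tri_lattice (fls_X * u) (fls_const c * u) 1" for x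
    proof
      assume "x \<in> L"
      then obtain a b where ab: "a \<in> \<O>" "b \<in> \<O>" "x = vector [u * a, b]" "a $$ 0 = c * b $$ 0"
        unfolding memL c by blast
      define a' where "a' = (a - fls_const c * b) / fls_X"
      have "a' \<in> \<O>"
        unfolding a'_def divide_X_mem_integers_iff using ab by simp
      moreover have "fls_X * a' = a - fls_const c * b"
        by (simp only: a'_def times_divide_eq_right nonzero_mult_div_cancel_left[OF fls_X_nonzero])
      then have "a = fls_X * a' + fls_const c * b"
        by simp
      then have "x = vector [fls_X * u * a' + fls_const c * u * b, 1 * b]"
        unfolding ab(3) by (simp add: algebra_simps)
      ultimately show "x \<in> tri_lattice (fls_X * u) (fls_const c * u) 1"
        unfolding mem_tri_lattice using ab(2) by blast
    next
      assume "x \<in> tri_lattice (fls_X * u) (fls_const c * u) 1"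
      then obtain a b where ab: "a \<in> \<O>" "b \<in> \<O>"
          "x = vector [fls_X * u * a + fls_const c * u * b, 1 * b]"
        unfolding mem_tri_lattice by blast
      then have "x = vector [u * (fls_X * a + fls_const c * b), b]"
        by (simp add: algebra_simps)
      moreover have "(fls_X * a + fls_const c * b) $$ 0 = c * b $$ 0"
        using ab by (simp add: integers_nth_0_mult)
      ultimately show "x \<in> L"
        unfolding memL c using ab(1,2) by (metis integers_closed(3,4,7,9))
    qed
    then show ?thesis by blast
  qed
qed

lemma tri_lattice_mult: "(*v) (tri a x b) ` tri_lattice u y w = tri_lattice (a * u) (a * y + x * w) (b * w)"
  by (simp add: image_image matrix_vector_mul_assoc tri_mult)

text \<open>An integral multiple of the first basis vector may be subtracted from the second one.\<close>

lemma tri_lattice_absorb: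
  assumes e: "e \<in> \<O>"
  shows "tri_lattice v (e * v) w = tri_lattice v 0 w"
proof -
  have 1: "vector [v * a + e * v * b, w * b] = vector [v * (a + e * b) + 0 * b, w * b]"
    "vector [v * a + 0 * b, w * b] = vector [v * (a - e * b) + e * v * b, w * b]" for a b
    by (simp_all add: algebra_simps)
  show ?thesis
  proof (intro equalityI subsetI)
    fix x assume "x \<in> tri_lattice v (e * v) w"
    then show "x \<in> tri_lattice v 0 w"
      unfolding mem_tri_lattice 1(1) by (meson e integers_closed(7,9))
  next
    fix x assume "x \<in> tri_lattice v 0 w"
    then show "x \<in> tri_lattice v (e * v) w"
      unfolding mem_tri_lattice 1(2) by (meson e integers_closed(8,9))
  qed
qed

text \<open>The shear by \<open>fls_const c * u\<close> fixes the lattices at both ends of the chain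
\<open>L \<supset> L' \<supset> fls_X L\<close>, and it carries a diagonal sublattice to the middle one, so both adjacencies are
images of the diagonal case.\<close>

lemma lattice_adj_shear:
  assumes "u \<noteq> 0"
  shows "lattice_adj (tri_lattice u 0 1) (tri_lattice (fls_X * u) (fls_const c * u) 1)"
  and "lattice_adj (tri_lattice (fls_X * u) (fls_const c * u) 1) (tri_lattice (fls_X * u) 0 fls_X)"
proof -
  let ?g = "(*v) (tri 1 (fls_const c * u) 1)"
  have g: "linear_iso ?g" by (simp add: linear_iso_tri)
  from lattice_adj_image[OF g lattice_adj_diag1[of u 1]] assms
  show "lattice_adj (tri_lattice u 0 1) (tri_lattice (fls_X * u) (fls_const c * u) 1)"
    using tri_lattice_absorb[of "fls_const c" u 1] by (simp add: tri_lattice_mult)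
  from lattice_adj_image[OF g lattice_adj_diag2[of "fls_X * u" 1]] assms
  show "lattice_adj (tri_lattice (fls_X * u) (fls_const c * u) 1) (tri_lattice (fls_X * u) 0 fls_X)"
    using tri_lattice_absorb[of "fls_const c" "fls_X * u" fls_X] by (simp add: tri_lattice_mult mult.assoc mult.left_commute mult.commute)
qed

text \<open>Some linear bijection carries the standard lattice to \<open>L\<close>, which reduces the claim to the
sublattices of the standard lattice listed above, each of which is adjacent to the multiple of
the standard lattice by the uniformizer.\<close>

lemma lattice_adj_sym:
  fixes L :: "('a::field fls ^ 2) set"
  assumes adj: "lattice_adj L L'"
  shows "lattice_adj L' ((*s) fls_X ` L)"
proof -
  have std: "standard_lattice = tri_lattice 1 0 (1 :: 'a fls)"
    by (simp add: tri_1 image_ident)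
  from adj have "is_lattice L" by (simp add: lattice_adj_def)
  then obtain g where g: "linear_iso g" "L = g ` tri_lattice 1 0 1"
    using std by (metis lattice_iso_standard)
  define M where "M = inv g ` L'"
  have L': "L' = g ` M"
    using g(1) by (simp add: M_def image_image linear_iso_bij bij_is_surj surj_f_inv_f)
  have XL: "(*s) fls_X ` L = g ` tri_lattice fls_X 0 fls_X"
    using g by (simp add: scale_tri_lattice flip: linear_iso_image_scale)
  have "lattice_adj (tri_lattice 1 0 1) M"
    using adj g L' lattice_adj_image_iff by metis
  from lattice_adj_diag_cases[OF _ this]
  have "lattice_adj M (tri_lattice fls_X 0 fls_X)"
    using lattice_adj_diag1[of 1 fls_X] lattice_adj_shear(2)[of 1] by auto
  then show ?thesis
    unfolding XL L' using g(1) by (rule lattice_adj_image[rotated])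
qed

section \<open>Homothety classes\<close>

lemma homothety_class_scale: "c \<noteq> 0 \<Longrightarrow> homothety_class ((*s) c ` L) = homothety_class L"
  unfolding homothety_class_def
proof (intro equalityI subsetI; clarsimp simp: image_image)
  fix d :: "'a fls" assume "c \<noteq> 0" "d \<noteq> 0"
  then show "\<exists>e. (\<lambda>x. (d * c) *s x) ` L = (*s) e ` L \<and> e \<noteq> 0"
    by (intro exI[of _ "d * c"]) auto
  show "\<exists>e. (*s) d ` L = (\<lambda>x. (e * c) *s x) ` L \<and> e \<noteq> 0"
    using \<open>c \<noteq> 0\<close> \<open>d \<noteq> 0\<close> by (intro exI[of _ "d / c"]) auto
qed

lemma homothety_class_eq_iff:
  "homothety_class L = homothety_class L' \<longleftrightarrow> (\<exists>c. c \<noteq> 0 \<and> L' = (*s) c ` L)"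
proof
  assume *: "homothety_class L = homothety_class L'"
  have "L' \<in> homothety_class L'"
    unfolding homothety_class_def by (intro CollectI exI[of _ 1]) simp
  then have "L' \<in> homothety_class L"
    using * by simp
  then show "\<exists>c. c \<noteq> 0 \<and> L' = (*s) c ` L"
    unfolding homothety_class_def by (elim CollectE exE conjE) (rule exI, simp)
qed (metis homothety_class_scale)

text \<open>A step in the tree can be lifted from any chosen representative of its source, so paths lift
to chains of lattices.\<close>

lemma tree_adj_representative:
  assumes "tree_adj (homothety_class L) w"
  obtains L' where "lattice_adj L L'" "w = homothety_class L'"
proof -
  obtain M M' where M: "lattice_adj M M'" "homothety_class M = homothety_class L"
      "w = homothety_class M'"
    using assms by (auto simp: tree_adj_iff)
  then obtain c where c: "c \<noteq> 0" "L = (*s) c ` M"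
    by (auto simp: homothety_class_eq_iff)
  show ?thesis
    using that[of "(*s) c ` M'"] M c
    by (simp add: lattice_adj_image linear_iso_scaling homothety_class_scale)
qed

lemma tree_adj_vertexE:
  assumes "tree_adj v w"
  obtains L where "is_lattice L" "v = homothety_class L"
  using assms that by (auto simp: tree_adj_iff lattice_adj_def)

lemma tree_adj_sym: "tree_adj v w \<Longrightarrow> tree_adj w v"
  unfolding tree_adj_iff using lattice_adj_sym homothety_class_scale fls_X_nonzero by metis

text \<open>A homothety class has at most one member that lies in \<open>L\<close> but not in the multiple of \<open>L\<close>
by the uniformizer. This makes the last lattice of a lifted path depend on the last vertex only,
and it separates neighbouring vertices by their lattices.\<close>

lemma homothetic_sublattice_eq:
  assumes L: "is_lattice L" and M: "is_lattice M" and c: "c \<noteq> 0"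
    and "M \<subseteq> L" "\<not> M \<subseteq> (*s) fls_X ` L"
    and "(*s) c ` M \<subseteq> L" "\<not> (*s) c ` M \<subseteq> (*s) fls_X ` L"
  shows "(*s) c ` M = M"
proof -
  \<comment> \<open>A nonunit factor would push a sublattice of \<open>L\<close> into the multiples of the uniformizer.\<close>
  have small: "(*s) d ` N \<subseteq> (*s) fls_X ` L" if "N \<subseteq> L" "0 < fls_subdegree d" for d N
  proof
    fix y assume "y \<in> (*s) d ` N"
    then obtain x where x: "x \<in> N" "y = d *s x" by blast
    have "d / fls_X \<in> \<O>"
      unfolding divide_mem_integers_iff[OF fls_X_nonzero] using that(2) by simp
    then have "(d / fls_X) *s x \<in> L"
      using L x that(1) lattice_scale by blast
    moreover have "fls_X * (d / fls_X) = d"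
      by (simp only: times_divide_eq_right nonzero_mult_div_cancel_left[OF fls_X_nonzero])
    then have "y = fls_X *s ((d / fls_X) *s x)"
      using x by (simp only: vector_smult_assoc)
    ultimately show "y \<in> (*s) fls_X ` L" by blast
  qed
  have inv: "(*s) (inverse c) ` (*s) c ` M = M"
    using c by (simp add: image_image)
  have "fls_subdegree c = 0"
  proof (rule ccontr)
    assume "fls_subdegree c \<noteq> 0"
    then consider "0 < fls_subdegree c" | "0 < fls_subdegree (inverse c)"
      by (fastforce simp: fls_inverse_subdegree)
    then show False
    proof cases
      case 1
      then show False using small[of M c] assms by blast
    next
      case 2
      then show False using small[of "(*s) c ` M" "inverse c"] assms inv by simp
    qed
  qed
  then have "c \<in> \<O>" "inverse c \<in> \<O>"
    by (simp_all add: integers_iff_subdegree)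
  then have "(*s) c ` M \<subseteq> M" "(*s) (inverse c) ` M \<subseteq> M"
    using lattice_scale[OF M] by auto
  then show ?thesis
    using inv image_mono[of "(*s) (inverse c) ` M" M "(*s) c"] c by (auto simp: image_image)
qed

lemma lattice_adj_class_inj:
  assumes "lattice_adj L L1" "lattice_adj L L2" "homothety_class L1 = homothety_class L2"
  shows "L1 = L2"
proof -
  obtain c where "c \<noteq> 0" "L2 = (*s) c ` L1"
    using assms(3) by (auto simp: homothety_class_eq_iff)
  then show ?thesis
    using homothetic_sublattice_eq[of L L1 c] assms(1,2) unfolding lattice_adj_def by blast
qed

text \<open>Sublattices with simple quotient are maximal, so two different ones generate everything:
an element of one of them on which the functional of the other does not vanish corrects any
vector into that other.\<close>

lemma lattice_adj_sum:
  fixes L :: "('a::field fls ^ 2) set"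
  assumes L1: "lattice_adj L L1" and L2: "lattice_adj L L2" and ne: "L1 \<noteq> L2"
  shows "L1 + L2 = L"
proof -
  have lat: "is_lattice L" "L1 \<subseteq> L" "L2 \<subseteq> L"
    using L1 L2 by (auto simp: lattice_adj_def)
  \<comment> \<open>The two sublattices enter symmetrically once an element of one outside the other is chosen.\<close>
  have *: "L \<subseteq> A + B"
    if A: "lattice_adj L A" and B: "lattice_adj L B" and x: "x \<in> A" "x \<notin> B" for A B x
  proof
    have AB: "is_lattice A" "A \<subseteq> L" using A by (auto simp: lattice_adj_def)
    obtain \<phi> where "residue_map \<phi> L B"
      using B by (auto simp: lattice_adj_def quotient_iso_residue_iff)
    note \<phi> = residue_mapD[OF this]
    have \<phi>x: "x \<in> L" "\<phi> x \<noteq> 0" using x AB \<phi>(4) by auto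
    fix y assume y: "y \<in> L"
    define s where "s = fls_const (\<phi> y / \<phi> x) *s x"
    have s: "s \<in> A" "s \<in> L"
      using x \<phi>x lat AB by (auto simp: s_def lattice_scale)
    have "\<phi> y = \<phi> ((y - s) + s)" by simp
    also have "\<dots> = \<phi> (y - s) + \<phi> s"
      using s y lat by (intro \<phi>(1)) (auto simp: lattice_diff)
    also have "\<phi> s = \<phi> y"
      using \<phi>x by (simp add: s_def \<phi>(2))
    finally have "y - s \<in> B"
      using s y lat by (simp add: \<phi>(4) lattice_diff)
    then have "s + (y - s) \<in> A + B"
      using s by blast
    then show "y \<in> A + B" by simp
  qed
  have "L \<subseteq> L1 + L2"
  proof (cases "L1 \<subseteq> L2")
    case True
    with ne obtain x where "x \<in> L2" "x \<notin> L1" by blast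
    from *[OF L2 L1 this] show ?thesis by (simp add: add.commute)
  next
    case False
    then show ?thesis using *[OF L1 L2] by blast
  qed
  moreover have "L1 + L2 \<subseteq> L"
    using lat by (auto elim!: set_plus_elim simp: lattice_add subset_iff)
  ultimately show ?thesis by blast
qed

section \<open>Non-backtracking paths\<close>

lemma scale_set_plus: "(*s) (c :: 'a::field fls) ` (A + B) = (*s) c ` A + (*s) c ` (B :: ('a fls ^ 2) set)"
  by (auto simp: set_plus_def vector_add_ldistrib image_iff) (metis vector_add_ldistrib)+

lemma set_plus_absorb:
  fixes A B :: "('a::field fls ^ 2) set"
  assumes "is_lattice B" "0 \<in> A" "A \<subseteq> B"
  shows "A + B = B"
proof
  show "A + B \<subseteq> B"
    using assms by (auto elim!: set_plus_elim simp: lattice_add subset_iff)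
  show "B \<subseteq> A + B"
    using assms(2) by (rule set_zero_plus2)
qed

definition tree_path :: "(nat \<Rightarrow> 'a::field vertex) \<Rightarrow> nat \<Rightarrow> bool" where
  "tree_path p n \<longleftrightarrow> (\<forall>i\<le>n. tree_adj (p i) (p (i + 1))) \<and> (\<forall>i<n. p (i + 2) \<noteq> p i)"

text \<open>Along a lifted path \<open>L = L\<^sub>0 \<supset> L\<^sub>1 \<supset> \<dots>\<close> the invariants are \<open>L\<^sub>n = L\<^sub>n\<^sub>+\<^sub>1 + \<pi>\<^sup>n L\<close> and
\<open>L\<^sub>1 = L\<^sub>n\<^sub>+\<^sub>1 + \<pi> L\<close>, where \<open>\<pi>\<close> is the uniformizer. In the induction step the path does not
backtrack, so \<open>L\<^sub>n\<^sub>+\<^sub>2\<close> and \<open>\<pi> L\<^sub>n\<close> are different maximal sublattices of \<open>L\<^sub>n\<^sub>+\<^sub>1\<close> and generate it.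
Here \<open>M'\<close> and \<open>M\<close> stand for \<open>L\<^sub>n\<close> and \<open>L\<^sub>n\<^sub>+\<^sub>1\<close>.\<close>

lemma tree_path_lift:
  assumes "tree_path p n" "p 0 = homothety_class L"
  shows "\<exists>L1 M' M. lattice_adj L L1 \<and> p 1 = homothety_class L1 \<and>
    lattice_adj M' M \<and> p n = homothety_class M' \<and> p (n + 1) = homothety_class M \<and>
    M' = M + (*s) (fls_X ^ n) ` L \<and> L1 = M + (*s) fls_X ` L \<and> M \<subseteq> L"
  using assms(1)
proof (induction n)
  case 0
  then have "tree_adj (homothety_class L) (p 1)"
    using assms(2) by (simp add: tree_path_def)
  then obtain L1 where L1: "lattice_adj L L1" "p 1 = homothety_class L1"
    by (rule tree_adj_representative)
  then have lat: "is_lattice L" "is_lattice L1" "L1 \<subseteq> L" "(*s) fls_X ` L \<subseteq> L1"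
    by (auto simp: lattice_adj_def)
  have "L1 + L = L" "L1 + (*s) fls_X ` L = L1"
    using lat set_plus_absorb[of L L1] set_plus_absorb[of L1 "(*s) fls_X ` L"]
    by (auto simp: lattice_zero add.commute image_iff intro: bexI[of _ 0])
  then show ?case
    using L1 lat assms(2) by (intro exI[of _ L1] exI[of _ L]) auto
next
  case (Suc n)
  then have "tree_path p n" and step: "tree_adj (p (n + 1)) (p (n + 2))" "p (n + 2) \<noteq> p n"
    by (auto simp: tree_path_def)
  with Suc.IH obtain L1 M' M where IH: "lattice_adj L L1" "p 1 = homothety_class L1"
    "lattice_adj M' M" "p n = homothety_class M'" "p (n + 1) = homothety_class M"
    "M' = M + (*s) (fls_X ^ n) ` L" "L1 = M + (*s) fls_X ` L" "M \<subseteq> L"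
    by blast
  from step(1) obtain N where N: "lattice_adj M N" "p (n + 2) = homothety_class N"
    unfolding IH(5) by (rule tree_adj_representative)
  have lat: "is_lattice L" "is_lattice M" "is_lattice N" "N \<subseteq> M" "(*s) fls_X ` M \<subseteq> N"
    using IH N by (auto simp: lattice_adj_def)
  have "N \<noteq> (*s) fls_X ` M'"
    using step(2) N(2) IH(4) by (metis homothety_class_scale fls_X_nonzero)
  then have "M = N + (*s) fls_X ` M'"
    using lattice_adj_sum[OF N(1) lattice_adj_sym[OF IH(3)]] by simp
  also have "\<dots> = ((*s) fls_X ` M + N) + (*s) (fls_X ^ Suc n) ` L"
    unfolding IH(6) scale_set_plus by (simp add: image_image add.assoc add.left_commute)
  also have "(*s) fls_X ` M + N = N"
    using lat by (intro set_plus_absorb) (auto simp: lattice_zero image_iff intro: bexI[of _ 0])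
  finally have M: "M = N + (*s) (fls_X ^ Suc n) ` L" .
  have "(*s) (fls_X ^ Suc n) ` L \<subseteq> (*s) fls_X ` L"
  proof -
    have "(*s) (fls_X ^ n) ` L \<subseteq> L"
      using lattice_scale[OF lat(1)] by (auto simp: integers_iff_subdegree)
    from image_mono[OF this, of "(*s) fls_X"] show ?thesis
      by (simp add: image_image)
  qed
  moreover have "0 \<in> (*s) (fls_X ^ Suc n) ` L"
    using lat(1) by (auto simp: lattice_zero image_iff intro: bexI[of _ 0])
  ultimately have "(*s) (fls_X ^ Suc n) ` L + (*s) fls_X ` L = (*s) fls_X ` L"
    using lat(1) by (intro set_plus_absorb is_lattice_image linear_iso_scaling) auto
  then have "N + (*s) (fls_X ^ Suc n) ` L + (*s) fls_X ` L = N + (*s) fls_X ` L"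
    by (simp only: add.assoc)
  then have "L1 = N + (*s) fls_X ` L"
    by (simp only: IH(7) flip: M)
  moreover have "N \<subseteq> L"
    using lat IH(8) by blast
  ultimately show ?case
    using IH(1,2,5) N M by (intro exI[of _ L1] exI[of _ M] exI[of _ N]) (simp only: Suc_eq_plus1 add_2_eq_Suc' simp_thms)
qed

text \<open>The absence of circuits, in the form needed for counting. The lifts of both paths from one
representative end in homothetic lattices. Neither end lies in \<open>\<pi> L\<close>, for otherwise
\<open>L\<^sub>1 = L\<^sub>n\<^sub>+\<^sub>1 + \<pi> L\<close> would be contained in \<open>\<pi> L\<close>; hence the ends agree, and the same formula recovers
the first step.\<close>

lemma tree_path_first_step_unique:
  assumes p: "tree_path p n" and p': "tree_path p' n"
    and start: "p 0 = p' 0" and end_eq: "p (n + 1) = p' (n + 1)"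
  shows "p 1 = p' 1"
proof -
  have "tree_adj (p 0) (p 1)" using p by (auto simp: tree_path_def)
  then obtain L where L: "is_lattice L" "p 0 = homothety_class L"
    by (rule tree_adj_vertexE)
  obtain L1 M where M: "lattice_adj L L1" "p 1 = homothety_class L1" "is_lattice M"
      "p (n + 1) = homothety_class M" "L1 = M + (*s) fls_X ` L" "M \<subseteq> L"
    using tree_path_lift[OF p L(2)] by (auto simp: lattice_adj_def)
  obtain L1' M' where M': "lattice_adj L L1'" "p' 1 = homothety_class L1'" "is_lattice M'"
      "p' (n + 1) = homothety_class M'" "L1' = M' + (*s) fls_X ` L" "M' \<subseteq> L"
    using tree_path_lift[OF p', of L] L start by (auto simp: lattice_adj_def)
  obtain c where c: "c \<noteq> 0" "M' = (*s) c ` M"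
    using end_eq M(4) M'(4) by (auto simp: homothety_class_eq_iff)
  have XL: "is_lattice ((*s) fls_X ` L)"
    using L(1) by (intro is_lattice_image linear_iso_scaling) auto
  have proper: "\<not> N \<subseteq> (*s) fls_X ` L" if "lattice_adj L (N + (*s) fls_X ` L)" "is_lattice N" for N
    using that set_plus_absorb[OF XL lattice_zero[OF that(2)]]
    by (auto simp: lattice_adj_def)
  have "(*s) c ` M = M"
    using homothetic_sublattice_eq[OF L(1) M(3) c(1)] M M' c proper by metis
  then show ?thesis using M M' c by simp
qed

section \<open>Descendants\<close>

lemma Desc_iff_tree_path:
  "w \<in> Desc N (y, z) \<longleftrightarrow> (\<exists>p. p 0 = y \<and> p 1 = z \<and> p (N + 1) = w \<and> tree_path p N)"
  by (simp add: Desc_def tree_path_def)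

lemma Desc_0: "tree_adj y z \<Longrightarrow> Desc 0 (y, z) = {z}"
  unfolding set_eq_iff Desc_iff_tree_path
  by (auto simp: tree_path_def intro!: exI[of _ "\<lambda>i. if i = 0 then y else z"])

lemma tree_path_Suc:
  "tree_path p (Suc n) \<longleftrightarrow> tree_adj (p 0) (p 1) \<and> p 2 \<noteq> p 0 \<and> tree_path (\<lambda>i. p (Suc i)) n"
  by (simp add: tree_path_def All_less_Suc2 numeral_2_eq_2 flip: less_Suc_eq_le) auto

lemma Desc_Suc:
  assumes "tree_adj y z"
  shows "Desc (Suc N) (y, z) = (\<Union>x\<in>{x. tree_adj z x \<and> x \<noteq> y}. Desc N (z, x))"
proof (intro equalityI subsetI)
  fix w assume "w \<in> Desc (Suc N) (y, z)"
  then obtain p where p: "p 0 = y" "p 1 = z" "p (N + 2) = w" "tree_path p (Suc N)"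
    by (auto simp: Desc_iff_tree_path)
  then have q: "p 2 \<noteq> y" "tree_path (\<lambda>i. p (Suc i)) N"
    by (auto simp: tree_path_Suc)
  then have "tree_adj z (p 2)"
    using p(2) unfolding tree_path_def by (auto simp: numeral_2_eq_2 dest: spec[of _ 0])
  moreover have "w \<in> Desc N (z, p 2)"
    unfolding Desc_iff_tree_path using p q
    by (intro exI[of _ "\<lambda>i. p (Suc i)"]) (auto simp: numeral_2_eq_2)
  ultimately show "w \<in> (\<Union>x\<in>{x. tree_adj z x \<and> x \<noteq> y}. Desc N (z, x))"
    using q by blast
next
  fix w assume "w \<in> (\<Union>x\<in>{x. tree_adj z x \<and> x \<noteq> y}. Desc N (z, x))"
  then obtain p where p: "p 1 \<noteq> y" "p 0 = z" "p (N + 1) = w" "tree_path p N"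
    by (auto simp: Desc_iff_tree_path)
  then show "w \<in> Desc (Suc N) (y, z)"
    unfolding Desc_iff_tree_path using assms
    by (intro exI[of _ "case_nat y p"]) (auto simp: tree_path_Suc numeral_2_eq_2)
qed

lemma Desc_disjoint:
  assumes "x \<noteq> x'"
  shows "Desc N (z, x) \<inter> Desc N (z, x') = {}"
  using tree_path_first_step_unique assms unfolding Desc_iff_tree_path disjoint_iff by metis

section \<open>Polynomials in t and their general linear group\<close>

lemma poly_in_t_nth:
  fixes p :: "'a::field poly"
  shows "poly (map_poly fls_const p) fls_X_inv $$ n = (if n \<le> 0 then coeff p (nat (- n)) else 0)"
proof (induction p arbitrary: n)
  case (pCons a p)
  have "poly (map_poly fls_const (pCons a p)) fls_X_inv =
      fls_const a + fls_X_inv * poly (map_poly fls_const p) fls_X_inv"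
    by (simp add: map_poly_pCons)
  moreover have "nat (- n) = Suc (nat (- (n + 1)))" if "n < 0"
    using that by simp
  ultimately show ?case
    by (auto simp: pCons.IH fls_X_inv_times_conv_shift coeff_pCons)
qed simp

text \<open>The positive coefficients of a Laurent series in the uniformizer are those of negative powers
of \<open>t\<close>, so polynomials are recognized by their vanishing.\<close>

lemma polynomials_in_t_iff: "x \<in> polynomials_in_t \<longleftrightarrow> (\<forall>n>0. x $$ n = 0)"
proof
  assume *: "\<forall>n>0. x $$ n = 0"
  have "x = poly (map_poly fls_const (fls_prpart x + [:x $$ 0:])) fls_X_inv"
    using * by (intro fls_eqI) (auto simp: poly_in_t_nth coeff_pCons split: nat.splits)
  then show "x \<in> polynomials_in_t"
    unfolding polynomials_in_t_def by blast
qed (auto simp: polynomials_in_t_def poly_in_t_nth)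

lemma polynomials_in_t_closed [simp]:
  fixes x y :: "'a::field fls"
  shows "(0 :: 'a fls) \<in> polynomials_in_t" and "(1 :: 'a fls) \<in> polynomials_in_t"
    and "fls_const c * fls_X_inv ^ n \<in> polynomials_in_t"
    and "x \<in> polynomials_in_t \<Longrightarrow> - x \<in> polynomials_in_t"
    and "x \<in> polynomials_in_t \<Longrightarrow> y \<in> polynomials_in_t \<Longrightarrow> x + y \<in> polynomials_in_t"
    and "x \<in> polynomials_in_t \<Longrightarrow> y \<in> polynomials_in_t \<Longrightarrow> x * y \<in> polynomials_in_t"
proof -
  show "x * y \<in> polynomials_in_t" if x: "x \<in> polynomials_in_t" and y: "y \<in> polynomials_in_t"
  proof -
    have "poly (map_poly fls_const p) fls_X_inv * y \<in> polynomials_in_t" for p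
    proof (induction p)
      case (pCons a p)
      have "poly (map_poly fls_const (pCons a p)) fls_X_inv * y =
          fls_const a * y + fls_shift 1 (poly (map_poly fls_const p) fls_X_inv * y)"
        by (simp add: map_poly_pCons distrib_right mult.assoc flip: fls_X_inv_times_conv_shift(1))
      then show ?case
        using pCons.IH y by (simp add: polynomials_in_t_iff)
    qed (simp add: polynomials_in_t_iff)
    then show ?thesis
      using x by (auto simp: polynomials_in_t_def)
  qed
qed (auto simp: polynomials_in_t_iff)

lemma polynomials_in_t_subdegree: "x \<in> polynomials_in_t \<Longrightarrow> fls_subdegree x \<le> 0"
  unfolding polynomials_in_t_iff by (metis fls_zero_subdegree nth_fls_subdegree_zero_iff not_le order_refl)

text \<open>The division step of the Euclidean algorithm: a Laurent series is a polynomial in \<open>t\<close> plus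
an element of the maximal ideal.\<close>

lemma polynomial_part:
  fixes x :: "'a::field fls"
  obtains p where "p \<in> polynomials_in_t" "x - p = 0 \<or> 0 < fls_subdegree (x - p)"
proof -
  define p where "p = poly (map_poly fls_const (fls_prpart x + [:x $$ 0:])) fls_X_inv"
  have "(x - p) $$ n = 0" if "n \<le> 0" for n
    using that by (auto simp: p_def poly_in_t_nth coeff_pCons split: nat.splits)
  then have "x - p = 0 \<or> 0 < fls_subdegree (x - p)"
    using nth_fls_subdegree_nonzero not_le by blast
  then show ?thesis
    using that[of p] by (auto simp: p_def polynomials_in_t_def)
qed

lemma GL2_poly_mult: "A \<in> GL2_poly \<Longrightarrow> B \<in> GL2_poly \<Longrightarrow> A ** B \<in> GL2_poly"
proof -
  assume "A \<in> GL2_poly" "B \<in> GL2_poly"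
  then obtain A' B' where *: "\<forall>i j. A $ i $ j \<in> polynomials_in_t" "\<forall>i j. B $ i $ j \<in> polynomials_in_t"
    "\<forall>i j. A' $ i $ j \<in> polynomials_in_t" "\<forall>i j. B' $ i $ j \<in> polynomials_in_t"
    "A ** A' = mat 1" "A' ** A = mat 1" "B ** B' = mat 1" "B' ** B = mat 1"
    unfolding GL2_poly_def by blast
  have "(A ** B) ** (B' ** A') = A ** (B ** B') ** A'" "(B' ** A') ** (A ** B) = B' ** (A' ** A) ** B"
    by (simp_all only: matrix_mul_assoc)
  with * show ?thesis
    unfolding GL2_poly_def
    by (auto intro!: exI[of _ "B' ** A'"] simp: matrix_matrix_mult_2)
qed

lemma GL2_poly_inverseE:
  assumes "A \<in> GL2_poly"
  obtains B where "B \<in> GL2_poly" "A ** B = mat 1" "B ** A = mat 1"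
  using assms unfolding GL2_poly_def by blast

lemma GL2_poly_invertible: "A \<in> GL2_poly \<Longrightarrow> invertible A"
  by (auto simp: invertible_def GL2_poly_def)

lemma swap_in_GL2_poly: "swap \<in> GL2_poly"
  unfolding GL2_poly_def
  by (auto simp: forall_2 matrix_2_eq_iff matrix_matrix_mult_2 intro!: exI[of _ swap])

lemma shear_in_GL2_poly: "p \<in> polynomials_in_t \<Longrightarrow> tri 1 p 1 \<in> GL2_poly"
  unfolding GL2_poly_def
  by (auto simp: forall_2 matrix_2_eq_iff matrix_matrix_mult_2 intro!: exI[of _ "tri 1 (- p) 1"])

lemma act_class: "act A (homothety_class L) = homothety_class ((*v) A ` L)"
  unfolding act_def homothety_class_def by (simp add: setcompr_eq_image image_image vector_scalar_commute)

lemma act_act: "act A (act B v) = act (A ** B) v"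
  by (simp add: act_def image_image matrix_vector_mul_assoc)

lemma act_1: "act (mat 1) v = v"
  by (simp add: act_def)

lemma tree_adj_act:
  assumes "A \<in> GL2_poly" "tree_adj v w"
  shows "tree_adj (act A v) (act A w)"
  using assms lattice_adj_image[OF linear_iso_matrix[OF GL2_poly_invertible]]
  unfolding tree_adj_iff by (metis act_class)

lemma ray_vertex_eq: "ray_vertex n = homothety_class (tri_lattice (fls_X_inv ^ n) 0 1)"
  by (simp add: ray_vertex_def act_class tri_def)

section \<open>Heights\<close>

text \<open>The relation underlying \<open>height\<close>, kept apart because existence and uniqueness of the height
are proved separately.\<close>

definition orbit_height :: "'a::field vertex \<Rightarrow> nat \<Rightarrow> bool" where
  "orbit_height v n \<longleftrightarrow> (\<exists>A\<in>GL2_poly. v = act A (ray_vertex n))"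

lemma orbit_height_act: "A \<in> GL2_poly \<Longrightarrow> orbit_height v n \<Longrightarrow> orbit_height (act A v) n"
  unfolding orbit_height_def by (auto simp: act_act intro: GL2_poly_mult)

lemma orbit_height_ray: "orbit_height (ray_vertex n) n"
  unfolding orbit_height_def
  using shear_in_GL2_poly[of 0] by (intro bexI[of _ "mat 1"]) (simp_all add: tri_1 act_1)

text \<open>The image of the first basis vector has a nonzero entry, and a nonzero polynomial has
valuation at most 0. Comparing with the valuations allowed in the target bounds \<open>m\<close>. If the factor
\<open>c\<close> had positive valuation, the whole second row of \<open>A\<close> would vanish.\<close>

lemma ray_image_bound:
  fixes A :: "'a::field fls ^ 2 ^ 2"
  assumes A: "A \<in> GL2_poly" and c: "c \<noteq> 0"
    and sub: "(*v) A ` tri_lattice (fls_X_inv ^ m) 0 1 \<subseteq> (*s) c ` tri_lattice (fls_X_inv ^ n) 0 1"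
  shows "fls_subdegree c \<le> 0" "int m \<le> int n - fls_subdegree c"
proof -
  obtain B where B: "A ** B = mat 1" "B ** A = mat 1"
    using A by (rule GL2_poly_inverseE)
  have deg: "fls_subdegree (A $ i $ j) \<le> 0" for i j
    using A by (auto simp: GL2_poly_def intro: polynomials_in_t_subdegree)
  let ?t = "fls_X_inv :: 'a fls"
  have cn: "c * ?t ^ n \<noteq> 0" using c by simp
  have mem: "(A *v v) $ 1 = 0 \<or> fls_subdegree c - int n \<le> fls_subdegree ((A *v v) $ 1)"
    "(A *v v) $ 2 = 0 \<or> fls_subdegree c \<le> fls_subdegree ((A *v v) $ 2)"
    if "v \<in> tri_lattice (?t ^ m) 0 1" for v
  proof -
    have "A *v v \<in> tri_lattice (c * ?t ^ n) 0 c"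
      using sub that by (auto simp: scale_tri_lattice)
    then show "(A *v v) $ 1 = 0 \<or> fls_subdegree c - int n \<le> fls_subdegree ((A *v v) $ 1)"
      "(A *v v) $ 2 = 0 \<or> fls_subdegree c \<le> fls_subdegree ((A *v v) $ 2)"
      unfolding mem_diag_lattice[OF cn c] divide_mem_integers_iff[OF cn] divide_mem_integers_iff[OF c]
      using c by (simp_all)
  qed
  have "A $ i $ 1 = 0 \<or> fls_subdegree (A $ i $ 1 * ?t ^ m) = fls_subdegree (A $ i $ 1) - int m" for i
    by (cases "A $ i $ 1 = 0") auto
  from this[of 1] this[of 2]
  have col1: "A $ 1 $ 1 = 0 \<or> int m + fls_subdegree c - int n \<le> 0"
    "A $ 2 $ 1 = 0 \<or> int m + fls_subdegree c \<le> 0"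
    using mem[of "vector [?t ^ m, 0]"] deg[of 1 1] deg[of 2 1]
    by (auto simp: mem_diag_lattice matrix_vector_mult_2)
  have col2: "A $ 2 $ 2 = 0 \<or> fls_subdegree c \<le> 0"
    using mem[of "vector [0, 1]"] deg[of 2 2]
    by (auto simp: mem_diag_lattice matrix_vector_mult_2)
  have "A $ 2 $ 1 \<noteq> 0 \<or> A $ 2 $ 2 \<noteq> 0" "A $ 1 $ 1 \<noteq> 0 \<or> A $ 2 $ 1 \<noteq> 0"
    using B by (auto simp: matrix_2_eq_iff matrix_matrix_mult_2)
  with col1 col2 show "fls_subdegree c \<le> 0" "int m \<le> int n - fls_subdegree c"
    by auto
qed

text \<open>The bound applies to the transporting matrix and to its inverse. The two sign conditions on
the homothety factor force it to be a unit, and then the two inequalities force equality.\<close>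

lemma orbit_height_unique:
  assumes "orbit_height v m" "orbit_height v n"
  shows "m = n"
proof -
  obtain A B where A: "A \<in> GL2_poly" "v = act A (ray_vertex m)"
      and B: "B \<in> GL2_poly" "v = act B (ray_vertex n)"
    using assms by (auto simp: orbit_height_def)
  obtain B' where B': "B' \<in> GL2_poly" "B' ** B = mat 1"
    using B(1) by (rule GL2_poly_inverseE)
  define C where "C = B' ** A"
  have C: "C \<in> GL2_poly" using A B' by (simp add: C_def GL2_poly_mult)
  then obtain C' where C': "C' \<in> GL2_poly" "C' ** C = mat 1"
    by (rule GL2_poly_inverseE)
  let ?Lm = "tri_lattice (fls_X_inv ^ m) 0 1" and ?Ln = "tri_lattice (fls_X_inv ^ n) 0 1"
  have "act B' (act A (ray_vertex m)) = act B' (act B (ray_vertex n))"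
    using A B by simp
  then have "act C (ray_vertex m) = ray_vertex n"
    by (simp add: act_act act_1 B' C_def)
  then have "homothety_class ?Ln = homothety_class ((*v) C ` ?Lm)"
    by (simp add: ray_vertex_eq act_class)
  then obtain c where c: "c \<noteq> 0" "(*v) C ` ?Lm = (*s) c ` ?Ln"
    by (auto simp: homothety_class_eq_iff)
  have "(*s) (inverse c) ` ?Lm = (*s) (inverse c) ` (*v) C' ` (*v) C ` ?Lm"
    by (simp add: image_image matrix_vector_mul_assoc matrix_mul_assoc C')
  also have "\<dots> = (*v) C' ` ?Ln"
    unfolding c(2) using c(1) by (simp add: image_image vector_scalar_commute)
  finally have "(*v) C' ` ?Ln \<subseteq> (*s) (inverse c) ` ?Lm" by simp
  from ray_image_bound[OF C'(1) _ this] ray_image_bound[OF C c(1), of m n] c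
  show ?thesis by (simp add: fls_inverse_subdegree)
qed

lemma height_eq: "orbit_height v n \<Longrightarrow> height v = n"
  unfolding height_def using orbit_height_unique
  by (intro the_equality) (auto simp: orbit_height_def)

lemma diag_lattice_cong:
  assumes "u \<noteq> 0" "u' \<noteq> 0" "w \<noteq> 0" "w' \<noteq> 0"
    and "fls_subdegree u = fls_subdegree u'" "fls_subdegree w = fls_subdegree w'"
  shows "tri_lattice u 0 w = tri_lattice u' 0 w'"
  unfolding set_eq_iff using assms by (simp add: mem_diag_lattice divide_mem_integers_iff)

text \<open>Exchanging the coordinates and then clearing the corner with the entry of least valuation
restores triangular shape; the determinant is preserved up to sign, which fixes the new first
diagonal entry.\<close>

lemma swap_lattice:
  fixes u y w :: "'a::field fls"
  assumes y: "y \<noteq> 0" and uy: "u / y \<in> \<O>"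
  shows "(*v) swap ` tri_lattice u y w = tri_lattice (u * w / y) w y"
proof -
  have swap_vec: "swap *v vector [a, b] = vector [b, a]" for a b :: "'a fls"
    by (simp add: vector_2_eq_iff matrix_vector_mult_2)
  have 1: "(vector [w * b, u * a + y * b] :: 'a fls ^ 2) =
      vector [(u * w / y) * (- a) + w * (b + (u / y) * a), y * (b + (u / y) * a)]"
    and 2: "(vector [(u * w / y) * a + w * b, y * b] :: 'a fls ^ 2) =
      vector [w * (b + (u / y) * a), u * (- a) + y * (b + (u / y) * a)]" for a b
    using y by (simp_all add: vector_2_eq_iff field_simps)
  show ?thesis
  proof (intro equalityI subsetI)
    fix v assume "v \<in> (*v) swap ` tri_lattice u y w"
    then obtain v' where v': "v' \<in> tri_lattice u y w" "v = swap *v v'" by blast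
    then obtain a b where ab: "a \<in> \<O>" "b \<in> \<O>" "v = vector [w * b, u * a + y * b]"
      unfolding mem_tri_lattice by (auto simp: swap_vec)
    show "v \<in> tri_lattice (u * w / y) w y"
      unfolding mem_tri_lattice ab(3) 1
      by (rule bexI[of _ "- a"], rule bexI[of _ "b + u / y * a"], rule refl) (use ab integers_closed(9)[OF uy, of a] in simp_all)
  next
    fix v assume "v \<in> tri_lattice (u * w / y) w y"
    then obtain a b where ab: "a \<in> \<O>" "b \<in> \<O>"
        "v = swap *v vector [u * (- a) + y * (b + (u / y) * a), w * (b + (u / y) * a)]"
      unfolding mem_tri_lattice 2 swap_vec by blast
    moreover have "vector [u * (- a) + y * (b + (u / y) * a), w * (b + (u / y) * a)]
        \<in> tri_lattice u y w"
      unfolding mem_tri_lattice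
      by (rule bexI[of _ "- a"], rule bexI[of _ "b + u / y * a"], rule refl) (use ab integers_closed(9)[OF uy, of a] in simp_all)
    ultimately show "v \<in> (*v) swap ` tri_lattice u y w" by blast
  qed
qed

lemma swap_diag_lattice:
  fixes u w :: "'a::field fls"
  assumes "u \<noteq> 0" "w \<noteq> 0"
  shows "(*v) swap ` tri_lattice u 0 w = tri_lattice w 0 u"
proof -
  have *: "swap *v v \<in> tri_lattice w 0 u \<longleftrightarrow> v \<in> tri_lattice u 0 w" for v
    using assms by (auto simp: mem_diag_lattice matrix_vector_mult_2)
  have **: "swap *v (swap *v v) = v" for v :: "'a fls ^ 2"
    by (simp add: vector_2_eq_iff matrix_vector_mult_2)
  show ?thesis
  proof (intro equalityI subsetI)
    fix v assume "v \<in> tri_lattice w 0 u"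
    then have "swap *v v \<in> tri_lattice u 0 w"
      using *[of "swap *v v"] ** by simp
    then show "v \<in> (*v) swap ` tri_lattice u 0 w"
      using ** by (metis imageI)
  next
    fix v assume "v \<in> (*v) swap ` tri_lattice u 0 w"
    then obtain v' where "v' \<in> tri_lattice u 0 w" "v = swap *v v'" by blast
    then show "v \<in> tri_lattice w 0 u" using * by simp
  qed
qed

lemma orbit_height_class_image:
  assumes "A \<in> GL2_poly" "orbit_height (homothety_class ((*v) A ` L)) n"
  shows "orbit_height (homothety_class L) n"
proof -
  obtain B where "B \<in> GL2_poly" "B ** A = mat 1"
    using assms(1) by (rule GL2_poly_inverseE)
  moreover from \<open>B ** A = mat 1\<close> have "act B (homothety_class ((*v) A ` L)) = homothety_class L"
    by (simp add: act_act act_1 flip: act_class)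
  ultimately show ?thesis
    using orbit_height_act assms(2) by metis
qed

lemma orbit_height_diag:
  assumes u: "u \<noteq> 0" and w: "w \<noteq> 0"
  shows "orbit_height (homothety_class (tri_lattice u 0 w))
    (nat \<bar>fls_subdegree u - fls_subdegree w\<bar>)"
proof -
  have *: "orbit_height (homothety_class (tri_lattice a 0 b)) (nat (fls_subdegree b - fls_subdegree a))"
    if "a \<noteq> 0" "b \<noteq> 0" "fls_subdegree a \<le> fls_subdegree b" for a b :: "'a fls"
  proof -
    let ?n = "nat (fls_subdegree b - fls_subdegree a)"
    have "(*s) b ` tri_lattice (fls_X_inv ^ ?n) 0 1 = tri_lattice (b * fls_X_inv ^ ?n) 0 b"
      by (simp add: scale_tri_lattice)
    also have "\<dots> = tri_lattice a 0 b"
      using that by (intro diag_lattice_cong) auto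
    finally have "homothety_class (tri_lattice a 0 b) = ray_vertex ?n"
      using homothety_class_scale[OF that(2)] by (metis ray_vertex_eq)
    then show ?thesis by (simp add: orbit_height_ray)
  qed
  show ?thesis
  proof (cases "fls_subdegree u \<le> fls_subdegree w")
    case True
    then show ?thesis using *[OF u w] by simp
  next
    case False
    then have "orbit_height (homothety_class ((*v) swap ` tri_lattice u 0 w))
        (nat \<bar>fls_subdegree u - fls_subdegree w\<bar>)"
      using *[OF w u] u w by (simp add: swap_diag_lattice)
    then show ?thesis by (rule orbit_height_class_image[OF swap_in_GL2_poly])
  qed
qed

text \<open>The Euclidean algorithm. After subtracting the polynomial part, the corner \<open>y\<close> has larger
valuation than \<open>w\<close>. If \<open>u\<close> divides \<open>y\<close>, the lattice is diagonal. Otherwise the exchange replaces the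
gap \<open>v(u) - v(w)\<close> of the diagonal valuations by \<open>v(u) + v(w) - 2 v(y)\<close>, which is smaller.\<close>

lemma orbit_height_tri:
  "u \<noteq> 0 \<Longrightarrow> w \<noteq> 0 \<Longrightarrow> \<exists>n. orbit_height (homothety_class (tri_lattice u x w)) n"
proof (induction "nat (fls_subdegree u - fls_subdegree w)" arbitrary: u x w rule: less_induct)
  case less
  note u = \<open>u \<noteq> 0\<close> and w = \<open>w \<noteq> 0\<close>
  obtain p where p: "p \<in> polynomials_in_t" "x / w - p = 0 \<or> 0 < fls_subdegree (x / w - p)"
    by (rule polynomial_part)
  define y where "y = x - p * w"
  have yw: "y / w = x / w - p"
    using w by (simp add: y_def field_simps)
  have "(*v) (tri 1 (- p) 1) ` tri_lattice u x w = tri_lattice u y w"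
    by (simp add: tri_lattice_mult y_def)
  then have shear: "\<exists>n. orbit_height (homothety_class (tri_lattice u x w)) n"
    if "orbit_height (homothety_class (tri_lattice u y w)) m" for m
    using orbit_height_class_image[OF shear_in_GL2_poly[of "- p"], of "tri_lattice u x w" m] p(1) that
    by auto
  show ?case
  proof (cases "y / u \<in> \<O>")
    case True
    then have "tri_lattice u y w = tri_lattice u 0 w"
      using tri_lattice_absorb[OF True, of u w] u by simp
    then show ?thesis using shear orbit_height_diag[OF u w] by metis
  next
    case False
    then have y: "y \<noteq> 0" "fls_subdegree y < fls_subdegree u"
      using u by (auto simp: divide_mem_integers_iff)
    have "fls_subdegree w < fls_subdegree y"
      using p(2) y(1) w by (auto simp: fls_divide_subdegree simp flip: yw)
    with y have "nat (fls_subdegree (u * w / y) - fls_subdegree y) < nat (fls_subdegree u - fls_subdegree w)"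
      using u w by (simp add: fls_divide_subdegree)
    then obtain n where "orbit_height (homothety_class (tri_lattice (u * w / y) w y)) n"
      using less.hyps[of "u * w / y" y w] u w y(1) by auto
    moreover have "u / y \<in> \<O>"
      using y by (simp add: divide_mem_integers_iff)
    ultimately have "orbit_height (homothety_class (tri_lattice u y w)) n"
      using orbit_height_class_image[OF swap_in_GL2_poly] swap_lattice[OF y(1)] by metis
    then show ?thesis by (rule shear)
  qed
qed

lemma orbit_height_exists:
  assumes "tree_adj v w"
  shows "orbit_height v (height v)"
proof -
  obtain n where "orbit_height v n"
    using assms by (metis tree_adj_vertexE lattice_triangular orbit_height_tri)
  then show ?thesis using height_eq by metis
qed

section \<open>Neighbours\<close>

text \<open>The shears that describe the side neighbours have the off-diagonal entry \<open>c * t ^ n\<close>, which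
is a polynomial. So a side neighbour lies in the orbit of a diagonal lattice with diagonal
valuations \<open>1 - n\<close> and 0, which has height \<open>n - 1\<close> for \<open>n > 0\<close>, and height 1 for \<open>n = 0\<close>.\<close>

lemma ray_neighbours:
  fixes n :: nat
  defines "t \<equiv> fls_X_inv :: 'a::field fls"
  defines "side \<equiv> \<lambda>c :: 'a. homothety_class (tri_lattice (fls_X * t ^ n) (fls_const c * t ^ n) 1)"
  shows "{w. tree_adj (ray_vertex n) w} = insert (ray_vertex (n + 1)) (range side)"
    and "inj side" and "ray_vertex (n + 1) \<notin> range side"
    and "orbit_height (side c) (if n = 0 then 1 else n - 1)"
proof -
  have t: "t \<noteq> 0" "t ^ n \<noteq> 0" by (simp_all add: t_def)
  have Xt: "fls_X * t = 1"
    by (simp add: t_def flip: fls_inverse_X)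
  let ?L = "tri_lattice (t ^ n) 0 1" and ?up = "tri_lattice (t ^ n) 0 fls_X"
  let ?side = "\<lambda>c. tri_lattice (fls_X * t ^ n) (fls_const c * t ^ n) 1"
  have up: "homothety_class ?up = ray_vertex (n + 1)"
  proof -
    have "?up = (*s) fls_X ` tri_lattice (t ^ (n + 1)) 0 1"
      using Xt by (simp add: scale_tri_lattice flip: mult.assoc)
    then show ?thesis
      by (simp only: homothety_class_scale[OF fls_X_nonzero] ray_vertex_eq t_def)
  qed
  have adj_up: "lattice_adj ?L ?up"
    using lattice_adj_diag2[of "t ^ n" 1] t by simp
  have adj_side: "lattice_adj ?L (?side c)" for c
    using lattice_adj_shear(1)[OF t(2)] .
  show "{w. tree_adj (ray_vertex n) w} = insert (ray_vertex (n + 1)) (range side)"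
  proof (intro equalityI subsetI)
    fix w :: "'a vertex" assume "w \<in> {w. tree_adj (ray_vertex n) w}"
    then obtain L' where "lattice_adj ?L L'" "w = homothety_class L'"
      unfolding ray_vertex_eq t_def by (auto elim: tree_adj_representative)
    then show "w \<in> insert (ray_vertex (n + 1)) (range side)"
      using lattice_adj_diag_cases[OF t(2)] up unfolding side_def by blast
  next
    fix w :: "'a vertex" assume "w \<in> insert (ray_vertex (n + 1)) (range side)"
    then show "w \<in> {w. tree_adj (ray_vertex n) w}"
      using adj_up adj_side up unfolding side_def tree_adj_iff ray_vertex_eq[of n] t_def by blast
  qed
  have mem: "vector [fls_const c * t ^ n, 1] \<in> ?side c" for c
    unfolding mem_tri_lattice by (rule bexI[of _ 0], rule bexI[of _ 1]) simp_all
  show "ray_vertex (n + 1) \<notin> range side"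
  proof
    assume "ray_vertex (n + 1) \<in> range side"
    then obtain c where "?side c = ?up"
      using lattice_adj_class_inj[OF adj_side adj_up] up unfolding side_def by auto
    with mem[of c] have "vector [fls_const c * t ^ n, 1] \<in> ?up" by simp
    then have "1 / fls_X \<in> (\<O> :: 'a fls set)"
      unfolding mem_diag_lattice[OF t(2) fls_X_nonzero] by (simp only: vector_2)
    then show False
      unfolding divide_mem_integers_iff[OF fls_X_nonzero] by simp
  qed
  show "inj side"
  proof (rule injI)
    fix c d assume "side c = side d"
    then have "?side c = ?side d"
      using lattice_adj_class_inj[OF adj_side adj_side] unfolding side_def by blast
    with mem[of c] have "vector [fls_const c * t ^ n, 1] \<in> ?side d" by simp
    then obtain a b where ab: "a \<in> \<O>" "(vector [fls_const c * t ^ n, 1] :: 'a fls ^ 2) =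
        vector [fls_X * t ^ n * a + fls_const d * t ^ n * b, 1 * b]"
      unfolding mem_tri_lattice by blast
    then have "fls_const c * t ^ n = fls_X * t ^ n * a + fls_const d * t ^ n"
      by (simp add: vector_2_eq_iff)
    then have "t ^ n * fls_const c = t ^ n * (fls_X * a + fls_const d)"
      by (simp add: algebra_simps)
    then have "fls_const c = fls_X * a + fls_const d"
      using t(2) mult_left_cancel by blast
    then have "fls_const c $$ 0 = (fls_X * a + fls_const d) $$ 0" by simp
    then show "c = d"
      using ab(1) by (simp add: integers_nth_0_mult)
  qed
  have "orbit_height (homothety_class (tri_lattice (fls_X * t ^ n) 0 1)) (if n = 0 then 1 else n - 1)"
    using orbit_height_diag[of "fls_X * t ^ n" 1] by (cases n) (auto simp: t_def nat_add_distrib)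
  moreover have "tri 1 (fls_const c * t ^ n) 1 \<in> GL2_poly" for c
    unfolding t_def by (intro shear_in_GL2_poly polynomials_in_t_closed)
  moreover have "side c = act (tri 1 (fls_const c * t ^ n) 1)
      (homothety_class (tri_lattice (fls_X * t ^ n) 0 1))" for c
    by (simp add: side_def act_class tri_lattice_mult)
  ultimately show "orbit_height (side c) (if n = 0 then 1 else n - 1)" for c
    by (simp only: orbit_height_act)
qed

text \<open>Elements of the polynomial group are automorphisms of the tree that preserve heights, so the
description of neighbours on the ray holds everywhere. For \<open>n = 0\<close> the distinguished neighbour
\<open>up\<close> has the same height as the others.\<close>

lemma neighbours:
  fixes v :: "'a::field vertex"
  assumes "orbit_height v n"
  obtains up and side :: "'a \<Rightarrow> 'a vertex" where
    "\<And>w. tree_adj v w \<longleftrightarrow> w = up \<or> w \<in> range side" "inj side" "up \<notin> range side"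
    "height up = n + 1" "\<And>c. height (side c) = (if n = 0 then 1 else n - 1)"
proof -
  obtain A where A: "A \<in> GL2_poly" "v = act A (ray_vertex n)"
    using assms by (auto simp: orbit_height_def)
  obtain B where B: "B \<in> GL2_poly" "B ** A = mat 1" "A ** B = mat 1"
    using A(1) by (rule GL2_poly_inverseE)
  have BA: "act B (act A w) = w" "act A (act B w) = w" for w
    by (simp_all add: act_act act_1 B)
  then have inj: "inj (act A)" by (metis injI)
  obtain side :: "'a \<Rightarrow> 'a vertex" where side:
    "{w. tree_adj (ray_vertex n) w} = insert (ray_vertex (n + 1)) (range side)" "inj side"
    "ray_vertex (n + 1) \<notin> range side" "\<And>c. orbit_height (side c) (if n = 0 then 1 else n - 1)"
    by (rule that[OF ray_neighbours])
  have "{w. tree_adj v w} = act A ` {w. tree_adj (ray_vertex n) w}"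
  proof (intro equalityI subsetI)
    fix w assume "w \<in> {w. tree_adj v w}"
    then have "tree_adj (ray_vertex n) (act B w)"
      using tree_adj_act[OF B(1)] A(2) BA by (metis mem_Collect_eq)
    then show "w \<in> act A ` {w. tree_adj (ray_vertex n) w}"
      using BA(2) by (metis image_eqI mem_Collect_eq)
  qed (use A tree_adj_act in auto)
  then have "{w. tree_adj v w} = insert (act A (ray_vertex (n + 1))) (range (act A \<circ> side))"
    by (simp add: side(1) image_comp)
  then have "tree_adj v w \<longleftrightarrow> w = act A (ray_vertex (n + 1)) \<or> w \<in> range (act A \<circ> side)" for w
    by (metis insert_iff mem_Collect_eq)
  moreover have "inj (act A \<circ> side)"
    using inj side(2) by (rule inj_compose)
  moreover have "act A (ray_vertex (n + 1)) \<notin> range (act A \<circ> side)"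
    using inj side(3) by (auto dest: injD)
  moreover have "height (act A (ray_vertex (n + 1))) = n + 1"
    "height ((act A \<circ> side) c) = (if n = 0 then 1 else n - 1)" for c
    using A(1) side(4) by (auto intro!: height_eq orbit_height_act orbit_height_ray)
  ultimately show ?thesis using that by blast
qed

section \<open>Counting descendants\<close>

lemma finite_Desc:
  fixes y :: "'a::{field,finite} vertex"
  shows "tree_adj y z \<Longrightarrow> finite (Desc N (y, z))"
proof (induction N arbitrary: y z)
  case (Suc N)
  obtain up and side :: "'a \<Rightarrow> 'a vertex" where "\<And>w. tree_adj z w \<longleftrightarrow> w = up \<or> w \<in> range side"
    by (rule neighbours[OF orbit_height_exists[OF tree_adj_sym[OF Suc.prems]]]) (rule that)
  then have "finite {w. tree_adj z w}"
    by - (rule finite_subset[of _ "insert up (range side)"], auto)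
  then show ?case
    using Suc by (simp add: Desc_Suc)
qed (simp add: Desc_0)

text \<open>The probability that the walk on heights which starts in state \<open>(\<epsilon>, k)\<close> is at height \<open>j\<close>
after \<open>N\<close> steps. Forward states have \<open>k > 0\<close>; the value at \<open>(Fwd, 0)\<close> has no meaning.\<close>

fun walk_prob :: "nat \<Rightarrow> orientation \<Rightarrow> nat \<Rightarrow> nat \<Rightarrow> nat \<Rightarrow> real" where
  "walk_prob q \<epsilon> k 0 j = of_bool (k = j)"
| "walk_prob q Fwd k (Suc N) j =
     walk_prob q Fwd (k + 1) N j / q + (1 - 1 / q) * walk_prob q Bwd (k - 1) N j"
| "walk_prob q Bwd 0 (Suc N) j = walk_prob q Fwd 1 N j"
| "walk_prob q Bwd (Suc k) (Suc N) j = walk_prob q Bwd k N j"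

text \<open>Removing \<open>y\<close> from the neighbours of \<open>z\<close> leaves one upward and \<open>q - 1\<close> downward steps if the
edge is forward, since \<open>y\<close> is then one of the lower neighbours. If the edge is backward, \<open>y\<close> has
height \<open>k + 1\<close>, and the \<open>q\<close> remaining neighbours are all in the same state.\<close>

lemma card_Desc:
  fixes y :: "'a::{field,finite} vertex"
  assumes "(y, z) \<in> state_edges \<epsilon> k"
  shows "real (card {w \<in> Desc N (y, z). height w = j}) =
    real CARD('a) ^ N * walk_prob CARD('a) \<epsilon> k N j"
  using assms
proof (induction N arbitrary: \<epsilon> k y z)
  case 0
  then have "tree_adj y z" "height z = k"
    by (cases \<epsilon>; simp)+
  then have "{w \<in> Desc 0 (y, z). height w = j} = (if k = j then {z} else {})"
    by (auto simp: Desc_0)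
  then show ?case by simp
next
  case (Suc N)
  let ?q = "CARD('a)"
  define count where "count e = real (card {w \<in> Desc N e. height w = j})" for e :: "'a vertex \<times> 'a vertex"
  have yz: "tree_adj y z" and k: "height z = k"
    using Suc.prems by (cases \<epsilon>; simp)+
  then have zy: "tree_adj z y" by (simp add: tree_adj_sym)
  obtain up and side :: "'a \<Rightarrow> 'a vertex" where nb:
    "\<And>w. tree_adj z w \<longleftrightarrow> w = up \<or> w \<in> range side" "inj side" "up \<notin> range side"
    "height up = k + 1" "\<And>c. height (side c) = (if k = 0 then 1 else k - 1)"
    by (rule neighbours[OF orbit_height_exists[OF zy], unfolded k]) (rule that)
  have z_up: "tree_adj z up" and z_side: "tree_adj z (side c)" for c
    by (simp_all add: nb(1))
  let ?next = "{x. tree_adj z x \<and> x \<noteq> y}"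
  have fin: "finite ?next"
    by (rule finite_subset[of _ "insert up (range side)"]) (auto simp: nb(1))
  have "{w \<in> Desc (Suc N) (y, z). height w = j} = (\<Union>x\<in>?next. {w \<in> Desc N (z, x). height w = j})"
    by (auto simp: Desc_Suc[OF yz])
  also have "card \<dots> = (\<Sum>x\<in>?next. card {w \<in> Desc N (z, x). height w = j})"
  proof (rule card_UN_disjoint[OF fin], goal_cases)
    case 1
    then show ?case by (simp add: finite_Desc)
  next
    case 2
    then show ?case using Desc_disjoint by blast
  qed
  finally have sum: "real (card {w \<in> Desc (Suc N) (y, z). height w = j}) = (\<Sum>x\<in>?next. count (z, x))"
    by (simp add: count_def)
  show ?case
  proof (cases \<epsilon>)
    case Fwd
    then have hy: "k = height y + 1" using Suc.prems by simp
    then obtain c0 where c0: "y = side c0"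
      using zy nb(1,4) by auto
    have "?next = insert up (side ` (- {c0}))"
      using nb(3) by (auto simp: nb(1) c0 inj_eq[OF nb(2)])
    moreover have "up \<notin> side ` (- {c0})" using nb(3) by blast
    moreover have "inj_on side (- {c0})" using nb(2) by (rule inj_on_subset) simp
    ultimately have "(\<Sum>x\<in>?next. count (z, x)) = count (z, up) + (\<Sum>c\<in>- {c0}. count (z, side c))"
      by (simp add: sum.reindex)
    also have "\<dots> = real ?q ^ N * walk_prob ?q Fwd (k + 1) N j +
        real (card (- {c0})) * (real ?q ^ N * walk_prob ?q Bwd (k - 1) N j)"
    proof -
      have "count (z, up) = real ?q ^ N * walk_prob ?q Fwd (k + 1) N j"
        unfolding count_def by (rule Suc.IH) (use nb(4) k z_up in simp)
      moreover have "count (z, side c) = real ?q ^ N * walk_prob ?q Bwd (k - 1) N j" for c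
        unfolding count_def by (rule Suc.IH) (use nb(5)[of c] k hy z_side in simp)
      ultimately show ?thesis by simp
    qed
    finally have "(\<Sum>x\<in>?next. count (z, x)) = real ?q ^ N * walk_prob ?q Fwd (k + 1) N j +
        real (card (- {c0})) * (real ?q ^ N * walk_prob ?q Bwd (k - 1) N j)" .
    moreover have "real (card (- {c0})) = real ?q - 1"
      by (simp add: Compl_eq_Diff_UNIV card_Diff_singleton of_nat_diff Suc_leI)
    moreover have "real ?q ^ Suc N * (a / ?q + (1 - 1 / ?q) * b) =
        real ?q ^ N * a + (real ?q - 1) * (real ?q ^ N * b)" for a b
      by (simp add: field_simps)
    ultimately show ?thesis
      unfolding sum Fwd walk_prob.simps(2) by presburger
  next
    case Bwd
    then have hy: "height y = k + 1" using Suc.prems by simp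
    have y_nb: "y \<in> insert up (range side)" using zy nb(1) by auto
    show ?thesis
    proof (cases k)
      case 0
      have "?next = insert up (range side) - {y}"
        using nb(1) by auto
      then have "card ?next = ?q"
        using y_nb nb(2,3) by (simp add: card_Diff_singleton_if card_image)
      moreover have "count (z, x) = real ?q ^ N * walk_prob ?q Fwd 1 N j" if "x \<in> ?next" for x
        unfolding count_def
      proof (rule Suc.IH)
        have "x \<in> insert up (range side)" using that nb(1) by auto
        then show "(z, x) \<in> state_edges Fwd 1"
          using nb(4,5) that k 0 by auto
      qed
      ultimately show ?thesis
        unfolding sum Bwd 0 by simp
    next
      case (Suc k')
      then have "y = up"
        using y_nb hy nb(5) by auto
      then have "?next = range side"
        using nb(1,3) by auto
      moreover have "count (z, side c) = real ?q ^ N * walk_prob ?q Bwd k' N j" for c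
        unfolding count_def by (rule Suc.IH) (use nb(5)[of c] k z_side Suc in simp)
      ultimately show ?thesis
        unfolding sum Bwd Suc using nb(2) by (simp add: sum.reindex)
    qed
  qed
qed

lemma state_edges_nonempty:
  assumes "\<epsilon> = Fwd \<Longrightarrow> k \<ge> 1"
  shows "(state_edges \<epsilon> k :: ('a::field vertex \<times> 'a vertex) set) \<noteq> {}"
proof -
  let ?v = "ray_vertex k :: 'a vertex"
  obtain up and side :: "'a \<Rightarrow> 'a vertex" where nb:
    "\<And>w. tree_adj ?v w \<longleftrightarrow> w = up \<or> w \<in> range side"
    "height up = k + 1" "\<And>c. height (side c) = (if k = 0 then 1 else k - 1)"
    by (rule neighbours[OF orbit_height_ray[of k]]) (rule that)
  have "tree_adj up ?v" "tree_adj (side 0) ?v"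
    using nb(1) by (simp_all add: tree_adj_sym)
  moreover have "height ?v = k"
    by (rule height_eq[OF orbit_height_ray])
  ultimately have "(case \<epsilon> of Fwd \<Rightarrow> side 0 | Bwd \<Rightarrow> up, ?v) \<in> state_edges \<epsilon> k"
    using nb(2) nb(3)[of 0] assms by (cases \<epsilon>) auto
  then show ?thesis by blast
qed

lemma mu_eq_walk_prob:
  assumes "\<epsilon> = Fwd \<Longrightarrow> k \<ge> 1"
  shows "mu TYPE('a::{field,finite}) \<epsilon> k N j = walk_prob CARD('a) \<epsilon> k N j"
proof -
  have "desc_freq N e j = walk_prob CARD('a) \<epsilon> k N j"
    if "e \<in> (state_edges \<epsilon> k :: ('a vertex \<times> 'a vertex) set)" for e
    using that card_Desc[of "fst e" "snd e" \<epsilon> k N j] by (simp add: desc_freq_def)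
  then have "(\<lambda>e. desc_freq N e j) ` (state_edges \<epsilon> k :: ('a vertex \<times> 'a vertex) set)
      = (\<lambda>_. walk_prob CARD('a) \<epsilon> k N j) ` (state_edges \<epsilon> k :: ('a vertex \<times> 'a vertex) set)"
    by (intro image_cong) simp_all
  moreover have "(state_edges \<epsilon> k :: ('a vertex \<times> 'a vertex) set) \<noteq> {}"
    using assms by (rule state_edges_nonempty)
  ultimately have "(\<lambda>e. desc_freq N e j) ` (state_edges \<epsilon> k :: ('a vertex \<times> 'a vertex) set)
      = {walk_prob CARD('a) \<epsilon> k N j}"
    by (simp add: image_constant_conv)
  then show ?thesis by (simp add: mu_def)
qed

section \<open>Distribution of the walk\<close>

lemma walk_prob_nonneg: "q \<ge> 1 \<Longrightarrow> walk_prob q \<epsilon> k N j \<ge> 0"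
  by (induction q \<epsilon> k N j rule: walk_prob.induct) auto

lemma walk_prob_below: "j + N < k \<Longrightarrow> walk_prob q \<epsilon> k N j = 0"
  by (induction q \<epsilon> k N j rule: walk_prob.induct) auto

lemma walk_prob_above: "k + N < j \<Longrightarrow> walk_prob q \<epsilon> k N j = 0"
  by (induction q \<epsilon> k N j rule: walk_prob.induct) auto

text \<open>A backward walk descends deterministically until it reaches height 0.\<close>

lemma walk_prob_Bwd_descend:
  "n \<le> k \<Longrightarrow> walk_prob q Bwd k (n + N) j = walk_prob q Bwd (k - n) N j"
proof (induction n arbitrary: k)
  case (Suc n)
  then show ?case by (cases k) auto
qed simp

lemma walk_prob_Bwd_short: "N \<le> k \<Longrightarrow> walk_prob q Bwd k N j = of_bool (k = j + N)"
  using walk_prob_Bwd_descend[of N k q 0 j] by (auto simp: of_bool_def)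

lemma walk_prob_Bwd_bounce: "walk_prob q Bwd k (k + Suc N) j = walk_prob q Fwd 1 N j"
  using walk_prob_Bwd_descend[of k k q "Suc N" j] by simp

text \<open>The initial excursion. When \<open>j\<close> exceeds \<open>N - k\<close>, a walk that has already bounced at height 0
cannot be at \<open>j\<close>, so the only contributing path makes \<open>i\<close> upward steps and then descends for
\<open>N - i\<close> steps, with no turn at all if \<open>i = N\<close>.\<close>

lemma walk_prob_Fwd_single_turn:
  assumes "N + j = k + 2 * i" "i < j" "k \<ge> 1"
  shows "walk_prob q Fwd k N j =
    (if i < N then (1 - 1 / q) / q ^ i else if i = N then 1 / q ^ N else 0)"
  using assms
proof (induction N arbitrary: k i)
  case (Suc N)
  have up: "walk_prob q Fwd (k + 1) N j =
      (case i of 0 \<Rightarrow> 0 | Suc i' \<Rightarrow>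
        (if i' < N then (1 - 1 / q) / q ^ i' else if i' = N then 1 / q ^ N else 0))"
  proof (cases i)
    case 0
    then show ?thesis using Suc.prems by (simp add: walk_prob_below)
  next
    case (Suc i')
    then show ?thesis using Suc.prems Suc.IH[of "k + 1" i'] by simp
  qed
  have down: "walk_prob q Bwd (k - 1) N j = of_bool (i = 0)"
  proof (cases "N < k")
    case True
    then show ?thesis using Suc.prems by (auto simp: walk_prob_Bwd_short)
  next
    case False
    then have "walk_prob q Bwd (k - 1) N j = walk_prob q Fwd 1 (N - k) j"
      using walk_prob_Bwd_bounce[of q "k - 1" "N - k" j] Suc.prems by simp
    also have "\<dots> = 0"
      using Suc.prems False by (intro walk_prob_above) auto
    finally show ?thesis using Suc.prems False by simp
  qed
  show ?case
    unfolding walk_prob.simps(2) up down by (cases i) auto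
qed auto

lemma rho_ev_eq:
  assumes "even j"
  shows "rho_ev q j = (if j = 0 then (real q - 1) / real q else ((real q)\<^sup>2 - 1) / real q ^ (j + 1))"
proof -
  have "- int j - 1 = - int (j + 1)" by simp
  then have "real q powi (- int j - 1) = inverse (real q ^ (j + 1))"
    by (simp only: power_int_minus power_int_of_nat)
  then show ?thesis
    using assms by (simp add: rho_ev_def divide_inverse)
qed

text \<open>For \<open>i > 0\<close> both continuations of the walk are covered by the induction hypothesis, the downward
one after its bounce at height 0, so their average is again \<open>rho_ev\<close>. The content is in the
boundary case \<open>N - k = j\<close>: for \<open>j > 0\<close> the upward continuation reaches \<open>j\<close> within its initial
excursion, the downward one by climbing straight from height 0, and the contributions sum to
\<open>(1 - 1 / q) * (1 + q) / q ^ j\<close>, which is \<open>rho_ev q j\<close>.\<close>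

lemma walk_prob_Fwd_stationary:
  assumes q: "q > 0" and j: "even j" and "k \<ge> 1" "N = k + j + 2 * i"
  shows "walk_prob q Fwd k N j = rho_ev q j"
  using assms(3,4)
proof (induction N arbitrary: k i rule: less_induct)
  case (less N)
  have "N \<noteq> 0" using less.prems by simp
  then obtain N' where N': "N = Suc N'" using not0_implies_Suc by blast
  show ?case
  proof (cases i)
    case (Suc i')
    have "walk_prob q Fwd (k + 1) N' j = rho_ev q j"
      using less.prems N' Suc by (intro less.IH[of _ _ i']) auto
    moreover have "N' = (k - 1) + Suc (j + 2 * i' + 1)"
      using less.prems N' Suc by simp
    then have "walk_prob q Bwd (k - 1) N' j = walk_prob q Fwd 1 (j + 2 * i' + 1) j"
      by (simp only: walk_prob_Bwd_bounce)
    moreover have "\<dots> = rho_ev q j"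
      using less.prems Suc by (intro less.IH[of _ _ i']) auto
    ultimately show ?thesis
      using q by (simp add: N' field_simps)
  next
    case 0
    show ?thesis
    proof (cases j)
      case 0
      have "walk_prob q Fwd (k + 1) N' j = 0"
        using less.prems N' \<open>i = 0\<close> 0 by (intro walk_prob_below) auto
      moreover have "walk_prob q Bwd (k - 1) N' j = 1"
        using less.prems N' \<open>i = 0\<close> 0 by (simp add: walk_prob_Bwd_short)
      ultimately show ?thesis
        using q 0 by (simp add: N' rho_ev_def field_simps)
    next
      case (Suc j')
      have "walk_prob q Fwd (k + 1) N' j = (1 - 1 / q) / q ^ j'"
        using less.prems N' \<open>i = 0\<close> Suc by (subst walk_prob_Fwd_single_turn[of _ _ _ j']) auto
      moreover have "walk_prob q Bwd (k - 1) N' j = walk_prob q Fwd 1 j' j"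
        using walk_prob_Bwd_bounce[of q "k - 1" "j'" j] less.prems N' \<open>i = 0\<close> Suc by simp
      moreover have "\<dots> = 1 / q ^ j'"
        using Suc by (subst walk_prob_Fwd_single_turn[of _ _ _ j']) auto
      ultimately have "walk_prob q Fwd k N j = (1 - 1 / q) / q ^ j' / q + (1 - 1 / q) / q ^ j'"
        by (simp add: N')
      also have "\<dots> = rho_ev q j"
        using q Suc rho_ev_eq[OF j] by (simp add: field_simps power2_eq_square)
      finally show ?thesis .
    qed
  qed
qed

text \<open>A backward walk first descends to 0 and bounces to \<open>(Fwd, 1)\<close>. This costs two units of
\<open>N - k\<close>, and by parity \<open>N - k > j\<close> leaves room for them.\<close>

lemma walk_prob_stationary:
  assumes "q > 0" "even j" "even (k + N)" "k + j < N" "\<epsilon> = Fwd \<Longrightarrow> k \<ge> 1"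
  shows "walk_prob q \<epsilon> k N j = rho_ev q j"
proof -
  have "even (N - (k + j + 2))" "k + j + 2 \<le> N"
    using assms by presburger+
  then obtain i where N: "N = k + j + 2 + 2 * i"
    by (metis dvd_def le_add_diff_inverse)
  show ?thesis
  proof (cases \<epsilon>)
    case Fwd
    then show ?thesis
      using assms N walk_prob_Fwd_stationary[of q j k N "i + 1"] by simp
  next
    case Bwd
    have "N = k + Suc (j + 1 + 2 * i)" using N by simp
    then have "walk_prob q Bwd k N j = walk_prob q Fwd 1 (j + 1 + 2 * i) j"
      by (simp only: walk_prob_Bwd_bounce)
    then show ?thesis
      using Bwd assms walk_prob_Fwd_stationary[of q j 1 "j + 1 + 2 * i" i] by simp
  qed
qed

section \<open>Integrals of finitely supported functions\<close>

lemma lebesgue_integral_point_measure_finite_support: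
  fixes \<Phi> :: "'a \<Rightarrow> complex" and f :: "'a \<Rightarrow> real"
  assumes "finite B" "B \<subseteq> A" "\<And>a. a \<in> A \<Longrightarrow> 0 \<le> f a" "\<And>a. a \<in> A - B \<Longrightarrow> \<Phi> a = 0"
  shows "(LINT a|point_measure A (\<lambda>a. ennreal (f a)). \<Phi> a) = (\<Sum>a\<in>B. of_real (f a) * \<Phi> a)"
proof -
  have "(LINT a|point_measure A (\<lambda>a. ennreal (f a)). \<Phi> a) = (LINT a|count_space A. f a *\<^sub>R \<Phi> a)"
    unfolding point_measure_def using assms(3)
    by (intro integral_density) (auto simp: AE_count_space)
  also have "\<dots> = (\<Sum>a | a \<in> A \<and> f a *\<^sub>R \<Phi> a \<noteq> 0. f a *\<^sub>R \<Phi> a)"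
    using assms by (intro lebesgue_integral_count_space_finite_support finite_subset[OF _ assms(1)]) auto
  also have "\<dots> = (\<Sum>a\<in>B. f a *\<^sub>R \<Phi> a)"
    using assms by (intro sum.mono_neutral_left) auto
  finally show ?thesis by (simp add: scaleR_conv_of_real)
qed

theorem proposition3p11:
  fixes \<epsilon> :: orientation and k N M R :: nat
  assumes "even (k + N)"
    and "k \<le> N" and "M = N - k"
    and "\<epsilon> = Fwd \<Longrightarrow> k \<ge> 1"
    and "even R"
    and "M > R"
  shows "(\<forall>j. even j \<and> j \<le> R \<longrightarrow>
            mu TYPE('a::{field,finite}) \<epsilon> k N j = rho_ev CARD('a) j) \<and>
         (\<forall>\<Phi> :: nat \<Rightarrow> complex. (\<forall>j. even j \<and> j > R \<longrightarrow> \<Phi> j = 0) \<longrightarrow>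
            (LINT j|mu_measure TYPE('a) \<epsilon> k N. \<Phi> j) = rho_ev_pairing CARD('a) \<Phi>)"
proof -
  let ?q = "CARD('a)" and ?mu = "mu TYPE('a) \<epsilon> k N"
  have mu: "?mu j = walk_prob ?q \<epsilon> k N j" for j
    by (rule mu_eq_walk_prob) (rule assms)
  have rho: "?mu j = rho_ev ?q j" if "even j" "j \<le> R" for j
    unfolding mu using that assms by (intro walk_prob_stationary) auto
  have "(LINT j|mu_measure TYPE('a) \<epsilon> k N. \<Phi> j) = rho_ev_pairing ?q \<Phi>"
    if \<Phi>: "\<forall>j. even j \<and> j > R \<longrightarrow> \<Phi> j = 0" for \<Phi> :: "nat \<Rightarrow> complex"
  proof -
    \<comment> \<open>The support condition constrains \<open>\<Phi>\<close> on even arguments only, so sums run over \<open>j = 2 * m\<close>.\<close>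
    have supp: "\<Phi> (2 * m) = 0" if "m \<notin> {..R div 2}" for m
    proof -
      have "R < 2 * m" using that by (simp add: not_le div_less_iff_less_mult mult.commute)
      then show ?thesis using \<Phi> by simp
    qed
    have "?mu j \<ge> 0" for j
      unfolding mu by (rule walk_prob_nonneg) (simp add: Suc_leI)
    then have "(LINT j|mu_measure TYPE('a) \<epsilon> k N. \<Phi> j) =
        (\<Sum>j\<in>(*) 2 ` {..R div 2}. of_real (?mu j) * \<Phi> j)"
      unfolding mu_measure_def using supp
      by (intro lebesgue_integral_point_measure_finite_support) (auto elim!: evenE)
    also have "\<dots> = (\<Sum>m\<le>R div 2. of_real (?mu (2 * m)) * \<Phi> (2 * m))"
      by (simp add: sum.reindex inj_on_def)
    also have "\<dots> = (\<Sum>m\<le>R div 2. of_real (rho_ev ?q (2 * m)) * \<Phi> (2 * m))"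
      using rho by (intro sum.cong) auto
    also have "\<dots> = rho_ev_pairing ?q \<Phi>"
      unfolding rho_ev_pairing_def
      by (intro suminf_finite[symmetric]) (simp_all add: supp)
    finally show ?thesis .
  qed
  with rho show ?thesis by blast
qed

end
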